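(* Let $E \subset \mathbb{T}$ be a closed set of logarithmic capacity $0$. Let $g \in \mathcal{D}$ be non-vanishing on $\mathbb{D}$, and let $f \in C(E)$ be non-vanishing on $E$. Then there exists a sequence of polynomials $P_n$ which do not vanish on the closed unit disc $\overline{\mathbb{D}}$ such that $P_n \to g$ in $\mathcal{D}$ and $P_n \to f$ uniformly on $E$.
   Context: The Dirichlet space $\mathcal D$ consists of holomorphic $f(z)=\sum_k a_kz^k$ on the unit disc $\mathbb{D}$ with $\|f\|_{\mathcal D}^2=\sum_{k\ge0}(k+1)|a_k|^2<\infty$. $C(E)$ is the space of continuous functions on $E$ with the sup norm. *)

theory Defs
  imports "HOL-Probability.Probability" "HOL-Computational_Algebra.Polynomial"
begin

definition taylor_coeff :: "(complex \<Rightarrow> complex) \<Rightarrow> nat \<Rightarrow> complex" where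
  "taylor_coeff f k = (deriv ^^ k) f 0 / of_nat (fact k)"

definition dirichlet_space :: "(complex \<Rightarrow> complex) set" where
  "dirichlet_space = {f. f holomorphic_on ball 0 1 \<and>
     summable (\<lambda>k. real (k + 1) * (cmod (taylor_coeff f k))\<^sup>2)}"

definition dirichlet_norm :: "(complex \<Rightarrow> complex) \<Rightarrow> real" where
  "dirichlet_norm f = sqrt (\<Sum>k. real (k + 1) * (cmod (taylor_coeff f k))\<^sup>2)"

text \<open>Logarithmic kernel log(1/|z-w|), split into positive and negative parts
  (the diagonal z = w contributes +infinity to the positive part).\<close>
definition log_kernel_pos :: "complex \<Rightarrow> complex \<Rightarrow> ennreal" where
  "log_kernel_pos z w = (if z = w then \<infinity> else ennreal (ln (1 / cmod (z - w))))"

definition log_kernel_neg :: "complex \<Rightarrow> complex \<Rightarrow> ennreal" where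
  "log_kernel_neg z w = (if z = w then 0 else ennreal (ln (cmod (z - w))))"

definition log_energy :: "complex measure \<Rightarrow> ereal" where
  "log_energy \<mu> =
     enn2ereal (\<integral>\<^sup>+ p. log_kernel_pos (fst p) (snd p) \<partial>(\<mu> \<Otimes>\<^sub>M \<mu>))
   - enn2ereal (\<integral>\<^sup>+ p. log_kernel_neg (fst p) (snd p) \<partial>(\<mu> \<Otimes>\<^sub>M \<mu>))"

definition prob_measures_on :: "complex set \<Rightarrow> complex measure set" where
  "prob_measures_on E = {\<mu>. sets \<mu> = sets borel \<and> prob_space \<mu> \<and>
                             emeasure \<mu> (space \<mu> - E) = 0}"

definition robin_constant :: "complex set \<Rightarrow> ereal" where
  "robin_constant E = (INF \<mu>\<in>prob_measures_on E. log_energy \<mu>)"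

definition log_capacity :: "complex set \<Rightarrow> real" where
  "log_capacity E = (if robin_constant E = \<infinity> then 0
                     else exp (- real_of_ereal (robin_constant E)))"

end

theory Submission
  imports Defs "HOL-Complex_Analysis.Complex_Analysis"
begin

text \<open>
  The heart of the matter is that a closed set \<open>E\<close> of capacity zero carries functions \<open>u\<close>,
  holomorphic across the closed disc, of arbitrarily small Dirichlet norm with \<open>Re u \<ge> 1\<close> on \<open>E\<close>
  and \<open>Re u \<ge> - 1\<close> on the disc. They are normalised potentials of Fekete points for the kernel
  \<open>- ln |1 - r z (cnj w)|\<close>; if the Fekete energies stayed bounded as \<open>r\<close> tends to 1, a weak limit of
  the counting measures would be a probability measure on \<open>E\<close> of finite logarithmic energy.

  Then \<open>1 - exp (- M u)\<close> is a bounded cutoff, close to 1 on \<open>E\<close> and small in Dirichlet norm. After a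
  dilation \<open>g = exp G\<close> with \<open>G\<close> holomorphic across the closed disc, and \<open>f = exp F\<close> on \<open>E\<close> since \<open>E\<close>
  does not separate the plane. If \<open>p\<close> is holomorphic across the closed disc and close to \<open>F - G\<close>
  on \<open>E\<close>, then \<open>exp (G + (1 - exp (- M u)) p)\<close> is close to \<open>g\<close> in Dirichlet norm and to \<open>f\<close> on \<open>E\<close>,
  and its Taylor polynomials do the job.
\<close>

section \<open>Parseval on circles and the Bergman norm\<close>

text \<open>Adding a correction to \<open>g\<close> could create zeros, so it is made in the
  exponent, where non-vanishing is automatic. But the exponent must stay bounded, and a function of
  small Dirichlet norm that is large on \<open>E\<close> has no uniform upper bound. Hence the
  cutoff: \<open>Re u \<ge> - 1\<close> bounds \<open>exp (- M u)\<close> by \<open>exp M\<close> on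
  the disc, and \<open>Re u \<ge> 1\<close> bounds it by \<open>exp (- M)\<close> on
  \<open>E\<close>. The order of choices matters: \<open>p\<close>, then \<open>M\<close>, then the
  constant \<open>C\<close> of the perturbation estimate, and only then \<open>u\<close>, with norm
  small compared with \<open>1 / C\<close>.

  The kernel is the real part of a function of \<open>z\<close> with Taylor coefficients
  \<open>(r cnj w) ^ k / k\<close>. The factor \<open>1 / k\<close> balances the Dirichlet weight
  \<open>k + 1\<close>, so the squared norm of the complex potential of a measure on the circle is
  at most twice the energy of the measure. A Fekete potential is at least \<open>V\<close> on
  \<open>E\<close> while its energy is at most \<open>V + 1\<close>; division by \<open>V\<close>
  therefore leaves a squared norm of at most \<open>4 / V\<close>, and it remains to make
  \<open>V\<close> large.\<close>

lemma taylor_coeff_sums: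
  assumes "h holomorphic_on ball 0 R" "cmod z < R"
  shows "(\<lambda>k. taylor_coeff h k * z ^ k) sums h z"
  using holomorphic_power_series[OF assms(1), of z] assms(2)
  by (simp add: taylor_coeff_def)

lemma taylor_coeff_summable_norm:
  assumes "h holomorphic_on ball 0 R" "0 \<le> s" "s < R"
  shows "summable (\<lambda>k. cmod (taylor_coeff h k) * s ^ k)"
proof -
  define K where "K = (s + R) / 2"
  have K: "s < K" "K < R" "0 \<le> K" using assms by (auto simp: K_def)
  have "summable (\<lambda>k. taylor_coeff h k * of_real K ^ k)"
    using taylor_coeff_sums[OF assms(1), of "of_real K"] K by (auto simp: sums_iff)
  from powser_insidea[OF this, of "of_real s"] show ?thesis
    using K assms by (simp add: norm_mult norm_power)
qed

lemma taylor_coeff_diff: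
  assumes "a holomorphic_on ball 0 1" "b holomorphic_on ball 0 1"
  shows "taylor_coeff (\<lambda>z. a z - b z) k = taylor_coeff a k - taylor_coeff b k"
  using higher_deriv_diff[OF assms, of 0 k]
  by (simp add: taylor_coeff_def diff_divide_distrib)

lemma taylor_coeff_deriv:
  "taylor_coeff (deriv h) k = of_nat (Suc k) * taylor_coeff h (Suc k)"
proof -
  have "(deriv ^^ k) (deriv h) = (deriv ^^ Suc k) h"
    by (simp add: funpow_Suc_right del: funpow.simps)
  moreover have "complex_of_nat (fact (Suc k)) = of_nat (Suc k) * of_nat (fact k)"
    by (simp only: fact_Suc of_nat_mult of_nat_id)
  ultimately show ?thesis
    by (simp add: taylor_coeff_def del: of_nat_Suc funpow.simps fact_Suc of_nat_fact)
qed

text \<open>Coefficients of polynomials, dilations and potentials are read off from explicit series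
  by this uniqueness statement instead of computing iterated derivatives.\<close>

lemma taylor_coeff_eqI:
  assumes "0 < R" "h holomorphic_on ball 0 R"
    "\<And>z. cmod z < R \<Longrightarrow> (\<lambda>k. a k * z ^ k) sums h z"
  shows "taylor_coeff h k = a k"
proof -
  have s: "summable (\<lambda>k. a k * z ^ k)" if "cmod z < R" for z
    using assms(3)[OF that] by (auto simp: sums_iff)
  have "ereal (R / 2) \<le> conv_radius a"
    using conv_radius_geI[OF s, of "of_real (R / 2)"] assms(1) by simp
  then have "fps_conv_radius (Abs_fps a) > 0"
    using assms(1) less_le_trans[of 0 "ereal (R / 2)" "conv_radius a"]
    by (simp add: fps_conv_radius_def)
  moreover have "eventually (\<lambda>z. z \<in> ball 0 R) (nhds 0)"
    using assms(1) by (intro eventually_nhds_in_open) auto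
  then have "eventually (\<lambda>z. eval_fps (Abs_fps a) z = h z) (nhds 0)"
    by eventually_elim (use assms(3) in \<open>auto simp: eval_fps_def sums_iff\<close>)
  ultimately have "h has_fps_expansion Abs_fps a"
    by (simp add: has_fps_expansion_def)
  from fps_nth_fps_expansion[OF this] have "(deriv ^^ k) h 0 / fact k = a k"
    by simp
  then show ?thesis by (simp add: taylor_coeff_def)
qed

section \<open>Orthogonality of the exponentials and Parseval's identity\<close>

lemma has_integral_cis_int:
  assumes "m \<noteq> (0::int)"
  shows "((\<lambda>t. cis (of_int m * t)) has_integral 0) {0..2*pi}"
proof -
  have "((\<lambda>t. cis (of_int m * t)) has_integral
      (cis (of_int m * (2*pi)) / (\<i> * of_int m) - cis (of_int m * 0) / (\<i> * of_int m))) {0..2*pi}"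
  proof (rule fundamental_theorem_of_calculus)
    fix x :: real
    have "((\<lambda>t. exp (\<i> * of_int m * of_real t) / (\<i> * of_int m)) has_vector_derivative
          exp (\<i> * of_int m * of_real x)) (at x within {0..2*pi})"
      using assms by (auto intro!: derivative_eq_intros has_vector_derivative_real_field)
    then show "((\<lambda>t. cis (of_int m * t) / (\<i> * of_int m)) has_vector_derivative
          cis (of_int m * x)) (at x within {0..2*pi})"
      by (simp add: cis_conv_exp mult_ac)
  qed auto
  moreover have "cis (of_int m * (2*pi)) = 1"
    using cis_multiple_2pi[of "of_int m"] by (simp add: mult_ac)
  ultimately show ?thesis by simp
qed

lemma cmod_add_power2:
  "(cmod (a + b))\<^sup>2 = (cmod a)\<^sup>2 + (cmod b)\<^sup>2 + 2 * Re (a * cnj b)"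
  by (simp add: cmod_power2) (simp add: power2_eq_square algebra_simps)

text \<open>In the induction, the cross term of the new frequency \<open>n\<close> with the earlier
  ones contains only the frequencies \<open>k - n\<close>, which are nonzero, and so integrates to
  0.\<close>

lemma has_integral_trig_poly_power2:
  "((\<lambda>t. (cmod (\<Sum>k<n. b k * cis (of_nat k * t)))\<^sup>2) has_integral
     (2 * pi * (\<Sum>k<n. (cmod (b k))\<^sup>2))) {0..2*pi}"
proof (induction n)
  case (Suc n)
  let ?P = "\<lambda>t. \<Sum>k<n. b k * cis (of_nat k * t)"
  have "((\<lambda>t. \<Sum>k<n. b k * cnj (b n) * cis (of_int (int k - int n) * t)) has_integral
      (\<Sum>k<n. b k * cnj (b n) * 0)) {0..2*pi}"
    by (intro has_integral_sum has_integral_mult_right has_integral_cis_int) auto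
  moreover have "(\<Sum>k<n. b k * cnj (b n) * cis (of_int (int k - int n) * t)) =
      ?P t * cnj (b n * cis (of_nat n * t))" for t
    unfolding sum_distrib_right
    by (rule sum.cong) (auto simp: cis_cnj left_diff_distrib cis_mult)
  ultimately have "((\<lambda>t. ?P t * cnj (b n * cis (of_nat n * t))) has_integral 0) {0..2*pi}"
    by simp
  from has_integral_linear[OF this bounded_linear_Re]
  have c: "((\<lambda>t. Re (?P t * cnj (b n * cis (of_nat n * t)))) has_integral 0) {0..2*pi}"
    by (simp add: o_def)
  have "((\<lambda>t. (cmod (?P t))\<^sup>2 + (cmod (b n))\<^sup>2 + 2 * Re (?P t * cnj (b n * cis (of_nat n * t))))
     has_integral (2 * pi * (\<Sum>k<n. (cmod (b k))\<^sup>2) + (2 * pi - 0) *\<^sub>R (cmod (b n))\<^sup>2 + 2 * 0)) {0..2*pi}"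
    by (intro has_integral_add has_integral_mult_right Suc c)
      (use has_integral_const_real[of "(cmod (b n))\<^sup>2" 0 "2*pi"] in simp)
  moreover have "(cmod (\<Sum>k<Suc n. b k * cis (of_nat k * t)))\<^sup>2 =
      (cmod (?P t))\<^sup>2 + (cmod (b n))\<^sup>2 + 2 * Re (?P t * cnj (b n * cis (of_nat n * t)))" for t
    unfolding sum.lessThan_Suc cmod_add_power2 by (simp add: norm_mult)
  moreover have "2 * pi * (\<Sum>k<n. (cmod (b k))\<^sup>2) + (2 * pi - 0) *\<^sub>R (cmod (b n))\<^sup>2 + 2 * 0 =
      2 * pi * (\<Sum>k<Suc n. (cmod (b k))\<^sup>2)"
    by (simp add: algebra_simps)
  ultimately show ?case by (simp only:)
qed simp

text \<open>The finite identity passes to the limit by dominated convergence, all partial sums being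
  bounded by \<open>\<Sum>k. cmod (b k)\<close>. The weight is written as a power of
  \<open>s\<^sup>2\<close> so that the sum is a power series in \<open>|z|\<^sup>2\<close>.\<close>

lemma circle_parseval:
  assumes h: "h holomorphic_on ball 0 R" and s: "0 \<le> s" "s < R"
  defines "c \<equiv> \<lambda>k. (cmod (taylor_coeff h k))\<^sup>2 * (s\<^sup>2) ^ k"
  shows "summable c"
    and "((\<lambda>t. (cmod (h (of_real s * cis t)))\<^sup>2) has_integral (2 * pi * suminf c)) {0..2*pi}"
proof -
  define b where "b k = taylor_coeff h k * of_real s ^ k" for k
  have nb: "cmod (b k) = cmod (taylor_coeff h k) * s ^ k" for k
    using s by (simp add: b_def norm_mult norm_power)
  have sb: "summable (\<lambda>k. cmod (b k))"
    unfolding nb by (rule taylor_coeff_summable_norm) fact+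
  have c: "c = (\<lambda>k. (cmod (b k))\<^sup>2)"
    by (auto simp: c_def nb power_mult_distrib simp flip: power_mult) (metis mult.commute)
  show sc: "summable c"
  proof -
    have "eventually (\<lambda>k. cmod (b k) < 1) sequentially"
      using summable_LIMSEQ_zero[OF sb] by (rule order_tendstoD) simp
    then have "eventually (\<lambda>k. norm (c k) \<le> cmod (b k)) sequentially"
      by eventually_elim (simp add: c power2_eq_square mult_left_le)
    from summable_comparison_test_ev[OF this sb] show ?thesis .
  qed
  define P where "P n t = (\<Sum>k<n. b k * cis (of_nat k * t))" for n t
  have lim: "(\<lambda>n. (cmod (P n t))\<^sup>2) \<longlonglongrightarrow> (cmod (h (of_real s * cis t)))\<^sup>2" for t
  proof -
    have "(\<lambda>k. taylor_coeff h k * (of_real s * cis t) ^ k) sums h (of_real s * cis t)"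
      using s by (intro taylor_coeff_sums[OF h]) (simp add: norm_mult)
    then have "(\<lambda>n. P n t) \<longlonglongrightarrow> h (of_real s * cis t)"
      by (simp add: sums_def P_def b_def power_mult_distrib Complex.DeMoivre mult_ac)
    then show ?thesis by (intro tendsto_intros)
  qed
  have bound: "cmod (P n t) \<le> (\<Sum>k. cmod (b k))" for n t
  proof -
    have "cmod (P n t) \<le> (\<Sum>k<n. cmod (b k))"
      unfolding P_def by (rule sum_norm_le) (simp add: norm_mult)
    also have "\<dots> \<le> (\<Sum>k. cmod (b k))" by (rule sum_le_suminf[OF sb]) auto
    finally show ?thesis .
  qed
  note I = has_integral_trig_poly_power2[of b, folded P_def]
  note dc = dominated_convergence[of "\<lambda>n t. (cmod (P n t))\<^sup>2" "{0..2*pi}"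
      "\<lambda>_. (\<Sum>k. cmod (b k))\<^sup>2" "\<lambda>t. (cmod (h (of_real s * cis t)))\<^sup>2"]
  have "(\<lambda>t. (cmod (h (of_real s * cis t)))\<^sup>2) integrable_on {0..2*pi}"
    by (rule dc(1)) (use I lim bound in \<open>auto intro!: power_mono simp: integrable_on_def\<close>)
  moreover have "(\<lambda>n. integral {0..2*pi} (\<lambda>t. (cmod (P n t))\<^sup>2)) \<longlonglongrightarrow>
      integral {0..2*pi} (\<lambda>t. (cmod (h (of_real s * cis t)))\<^sup>2)"
    by (rule dc(2)) (use I lim bound in \<open>auto intro!: power_mono simp: integrable_on_def\<close>)
  moreover have "(\<lambda>n. integral {0..2*pi} (\<lambda>t. (cmod (P n t))\<^sup>2)) \<longlonglongrightarrow> 2 * pi * suminf c"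
    unfolding integral_unique[OF I] c[symmetric]
    using summable_LIMSEQ[OF sc] by (intro tendsto_intros) (simp add: c)
  ultimately show "((\<lambda>t. (cmod (h (of_real s * cis t)))\<^sup>2) has_integral (2 * pi * suminf c)) {0..2*pi}"
    using LIMSEQ_unique has_integral_integrable_integral by blast
qed


lemma summable_taylor_coeff_power2:
  assumes "h holomorphic_on ball 0 R" "1 < R"
  shows "summable (\<lambda>k. (cmod (taylor_coeff h k))\<^sup>2)"
  using circle_parseval(1)[OF assms(1), of 1] assms(2) by simp

text \<open>By Parseval, the power series in \<open>t = |z|\<^sup>2\<close> of the difference of the two sides is nonnegative
  on \<open>[0, 1]\<close>; the weights \<open>1 / (k + 1)\<close> come from integrating it.\<close>

lemma bergman_norm_mono:
  assumes hol: "F holomorphic_on ball 0 R" "H holomorphic_on ball 0 R" "L holomorphic_on ball 0 R"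
    and R: "1 < R"
    and le: "\<And>z. z \<in> cball 0 1 \<Longrightarrow> (cmod (F z))\<^sup>2 \<le> A * (cmod (H z))\<^sup>2 + B * (cmod (L z))\<^sup>2"
  defines "\<beta> \<equiv> \<lambda>h. \<Sum>k. (cmod (taylor_coeff h k))\<^sup>2 / real (Suc k)"
  shows "\<beta> F \<le> A * \<beta> H + B * \<beta> L"
proof -
  define q where "q h k = (cmod (taylor_coeff h k))\<^sup>2" for h k
  define c where "c k = A * q H k + B * q L k - q F k" for k
  \<comment> \<open>Coefficients of the primitive, vanishing at 0, of the power series with
    coefficients \<open>c\<close>.\<close>
  define d where "d k = (case k of 0 \<Rightarrow> 0 | Suc j \<Rightarrow> c j / real (Suc j))" for k
  have diffs: "diffs d = c"
    by (auto simp: diffs_def d_def fun_eq_iff)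
  have sq: "summable (\<lambda>k. q h k * t ^ k)"
    "((\<lambda>x. (cmod (h (of_real (sqrt t) * cis x)))\<^sup>2) has_integral (2 * pi * (\<Sum>k. q h k * t ^ k))) {0..2*pi}"
    if "h holomorphic_on ball 0 R" "0 \<le> t" "sqrt t < R" for h t
    using circle_parseval[OF that(1), of "sqrt t"] that(2,3) by (simp_all add: q_def)
  have sc: "summable (\<lambda>k. c k * t ^ k)"
    "((\<lambda>x. A * (cmod (H (of_real (sqrt t) * cis x)))\<^sup>2 + B * (cmod (L (of_real (sqrt t) * cis x)))\<^sup>2
        - (cmod (F (of_real (sqrt t) * cis x)))\<^sup>2) has_integral (2 * pi * (\<Sum>k. c k * t ^ k))) {0..2*pi}"
    if t: "0 \<le> t" "sqrt t < R" for t
  proof -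
    note s = sq(1)[OF hol(1) t] sq(1)[OF hol(2) t] sq(1)[OF hol(3) t]
    have s': "(\<lambda>k. c k * t ^ k) sums (A * (\<Sum>k. q H k * t ^ k) + B * (\<Sum>k. q L k * t ^ k) - (\<Sum>k. q F k * t ^ k))"
    proof -
      have "(\<lambda>k. A * (q H k * t ^ k) + B * (q L k * t ^ k) - q F k * t ^ k) sums
          (A * (\<Sum>k. q H k * t ^ k) + B * (\<Sum>k. q L k * t ^ k) - (\<Sum>k. q F k * t ^ k))"
        by (intro sums_diff sums_add sums_mult summable_sums s)
      then show ?thesis by (simp add: c_def algebra_simps)
    qed
    then show "summable (\<lambda>k. c k * t ^ k)" by (rule sums_summable)
    have "((\<lambda>x. A * (cmod (H (of_real (sqrt t) * cis x)))\<^sup>2 + B * (cmod (L (of_real (sqrt t) * cis x)))\<^sup>2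
        - (cmod (F (of_real (sqrt t) * cis x)))\<^sup>2) has_integral
        (A * (2 * pi * (\<Sum>k. q H k * t ^ k)) + B * (2 * pi * (\<Sum>k. q L k * t ^ k)) - 2 * pi * (\<Sum>k. q F k * t ^ k))) {0..2*pi}"
      by (intro has_integral_diff has_integral_add has_integral_mult_right sq hol t)
    moreover have "A * (2 * pi * (\<Sum>k. q H k * t ^ k)) + B * (2 * pi * (\<Sum>k. q L k * t ^ k))
        - 2 * pi * (\<Sum>k. q F k * t ^ k) = 2 * pi * (\<Sum>k. c k * t ^ k)"
      unfolding sums_unique[OF s', symmetric] by (simp add: algebra_simps)
    ultimately show "((\<lambda>x. A * (cmod (H (of_real (sqrt t) * cis x)))\<^sup>2 + B * (cmod (L (of_real (sqrt t) * cis x)))\<^sup>2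
        - (cmod (F (of_real (sqrt t) * cis x)))\<^sup>2) has_integral (2 * pi * (\<Sum>k. c k * t ^ k))) {0..2*pi}"
      by (simp only:)
  qed
  have nonneg: "0 \<le> (\<Sum>k. c k * t ^ k)" if t: "0 \<le> t" "t \<le> 1" for t
  proof -
    have t': "sqrt t \<le> 1" using t by simp
    have "0 \<le> 2 * pi * (\<Sum>k. c k * t ^ k)"
    proof (rule has_integral_nonneg[OF sc(2)])
      fix x
      show "0 \<le> A * (cmod (H (of_real (sqrt t) * cis x)))\<^sup>2 + B * (cmod (L (of_real (sqrt t) * cis x)))\<^sup>2
        - (cmod (F (of_real (sqrt t) * cis x)))\<^sup>2"
        using le[of "of_real (sqrt t) * cis x"] t t' by (simp add: norm_mult)
    qed (use t t' R in linarith)+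
    then show ?thesis using pi_gt_zero by (metis mult_le_cancel_left_pos mult_zero_right zero_less_mult_iff zero_less_numeral)
  qed
  \<comment> \<open>A point beyond 1 at which the series still converges, so that termwise
    differentiation is valid on all of \<open>[0, 1]\<close>, including the endpoint 1.\<close>
  define K where "K = ((1 + R) / 2)\<^sup>2"
  have K: "1 < K" "sqrt K < R"
    using R by (simp_all add: K_def one_less_power)
  have sd: "summable (\<lambda>k. d k * K ^ k)"
  proof -
    have sK: "summable (\<lambda>k. \<bar>c k * K ^ k\<bar>)"
    proof (rule summable_comparison_test'[where N = 0])
      show "summable (\<lambda>k. \<bar>A\<bar> * (q H k * K ^ k) + \<bar>B\<bar> * (q L k * K ^ k) + q F k * K ^ k)"
        using K by (intro summable_add summable_mult sq hol) auto
      fix k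
      have "\<bar>A * q H k\<bar> = \<bar>A\<bar> * q H k" "\<bar>B * q L k\<bar> = \<bar>B\<bar> * q L k" "0 \<le> q F k"
        by (simp_all add: q_def abs_mult)
      then have "\<bar>c k\<bar> \<le> \<bar>A\<bar> * q H k + \<bar>B\<bar> * q L k + q F k"
        unfolding c_def by linarith
      then have "\<bar>c k\<bar> * K ^ k \<le> (\<bar>A\<bar> * q H k + \<bar>B\<bar> * q L k + q F k) * K ^ k"
        using K by (intro mult_right_mono) auto
      then show "norm \<bar>c k * K ^ k\<bar> \<le> \<bar>A\<bar> * (q H k * K ^ k) + \<bar>B\<bar> * (q L k * K ^ k) + q F k * K ^ k"
        using K by (simp add: abs_mult algebra_simps)
    qed
    have "summable (\<lambda>k. d (Suc k) * K ^ Suc k)"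
    proof (rule summable_comparison_test'[where N = 0])
      show "summable (\<lambda>k. K * \<bar>c k * K ^ k\<bar>)"
        using sK by (rule summable_mult)
      fix k
      have "\<bar>d (Suc k)\<bar> \<le> \<bar>c k\<bar>"
        using frac_le[of "\<bar>c k\<bar>" "\<bar>c k\<bar>" 1 "real (Suc k)"] by (simp add: d_def)
      then have "\<bar>d (Suc k)\<bar> * K ^ Suc k \<le> \<bar>c k\<bar> * K ^ Suc k"
        by (rule mult_right_mono) (use K in simp)
      then show "norm (d (Suc k) * K ^ Suc k) \<le> K * \<bar>c k * K ^ k\<bar>"
        using K by (simp add: abs_mult mult_ac)
    qed
    then show ?thesis by (subst (asm) summable_Suc_iff)
  qed
  define \<phi> where "\<phi> t = (\<Sum>k. d k * t ^ k)" for t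
  have phi_le: "\<phi> 0 \<le> \<phi> 1"
  proof (rule DERIV_nonneg_imp_nondecreasing[where f = \<phi>])
    fix t :: real assume t: "0 \<le> t" "t \<le> 1"
    have "(\<phi> has_field_derivative (\<Sum>k. diffs d k * t ^ k)) (at t)"
      unfolding \<phi>_def[abs_def] using t K by (intro termdiffs_strong[OF sd]) auto
    then show "\<exists>y. (\<phi> has_real_derivative y) (at t) \<and> 0 \<le> y"
      using nonneg[OF t] by (auto simp: diffs)
  qed simp
  have phi0: "\<phi> 0 = 0" by (simp add: \<phi>_def d_def)
  have sq1: "summable (\<lambda>k. q h k / real (Suc k))" if "h holomorphic_on ball 0 R" for h
  proof (rule summable_comparison_test'[where N = 0])
    show "summable (\<lambda>k. q h k)"
      using summable_taylor_coeff_power2[OF that R] by (simp add: q_def)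
    show "norm (q h k / real (Suc k)) \<le> q h k" for k
      using frac_le[of "q h k" "q h k" 1 "real (Suc k)"] by (simp add: q_def)
  qed
  have "\<phi> 1 = A * \<beta> H + B * \<beta> L - \<beta> F"
  proof -
    have "(\<lambda>k. A * (q H k / real (Suc k)) + B * (q L k / real (Suc k)) - q F k / real (Suc k)) sums
        (A * \<beta> H + B * \<beta> L - \<beta> F)"
      unfolding \<beta>_def q_def[symmetric]
      by (intro sums_diff sums_add sums_mult summable_sums sq1 hol)
    moreover have "A * (q H k / real (Suc k)) + B * (q L k / real (Suc k)) - q F k / real (Suc k) = d (Suc k)" for k
      by (simp add: d_def c_def diff_divide_distrib add_divide_distrib)
    ultimately have "(\<lambda>k. d (Suc k)) sums (A * \<beta> H + B * \<beta> L - \<beta> F)" by simp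
    then have "d sums (A * \<beta> H + B * \<beta> L - \<beta> F + d 0)"
      by (simp only: sums_Suc_iff diff_add_cancel)
    moreover have "d 0 = 0" by (simp add: d_def)
    ultimately show ?thesis by (simp add: \<phi>_def sums_iff)
  qed
  with phi_le phi0 show ?thesis by linarith
qed

section \<open>The Dirichlet norm\<close>

text \<open>Minkowski's inequality for finite sections, with the weight absorbed as
  \<open>sqrt (w k)\<close>; the resulting uniform bound on the partial sums also gives
  summability.\<close>

lemma weighted_l2_triangle:
  fixes x y :: "nat \<Rightarrow> complex" and w :: "nat \<Rightarrow> real"
  assumes w: "\<And>k. 0 \<le> w k"
    and x: "summable (\<lambda>k. w k * (cmod (x k))\<^sup>2)" and y: "summable (\<lambda>k. w k * (cmod (y k))\<^sup>2)"
  shows "summable (\<lambda>k. w k * (cmod (x k + y k))\<^sup>2)"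
    and "sqrt (\<Sum>k. w k * (cmod (x k + y k))\<^sup>2) \<le>
      sqrt (\<Sum>k. w k * (cmod (x k))\<^sup>2) + sqrt (\<Sum>k. w k * (cmod (y k))\<^sup>2)"
proof -
  define X where "X = sqrt (\<Sum>k. w k * (cmod (x k))\<^sup>2)"
  define Y where "Y = sqrt (\<Sum>k. w k * (cmod (y k))\<^sup>2)"
  have pos: "0 \<le> X" "0 \<le> Y"
    unfolding X_def Y_def using w by (auto intro!: suminf_nonneg x y)
  have part: "(\<Sum>k<n. w k * (cmod (x k + y k))\<^sup>2) \<le> (X + Y)\<^sup>2" for n
  proof -
    have sq: "sqrt (\<Sum>k<n. w k * (cmod (z k))\<^sup>2) = L2_set (\<lambda>k. sqrt (w k) * cmod (z k)) {..<n}" for z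
      using w by (simp add: L2_set_def power_mult_distrib)
    have "sqrt (\<Sum>k<n. w k * (cmod (x k + y k))\<^sup>2) \<le>
        L2_set (\<lambda>k. sqrt (w k) * cmod (x k) + sqrt (w k) * cmod (y k)) {..<n}"
      unfolding sq using w
      by (intro L2_set_mono) (auto simp flip: distrib_left intro!: mult_left_mono norm_triangle_ineq)
    also have "\<dots> \<le> L2_set (\<lambda>k. sqrt (w k) * cmod (x k)) {..<n} + L2_set (\<lambda>k. sqrt (w k) * cmod (y k)) {..<n}"
      by (rule L2_set_triangle_ineq)
    also have "\<dots> \<le> X + Y"
      unfolding X_def Y_def sq[symmetric] using w
      by (intro add_mono real_sqrt_le_mono sum_le_suminf x y) auto
    finally show ?thesis
      using pos by (metis add_nonneg_nonneg real_sqrt_le_iff real_sqrt_unique)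
  qed
  show s: "summable (\<lambda>k. w k * (cmod (x k + y k))\<^sup>2)"
    by (rule bounded_imp_summable[where B = "(X + Y)\<^sup>2"])
      (use w part[of "Suc _"] in \<open>auto simp: lessThan_Suc_atMost\<close>)
  have "(\<Sum>k. w k * (cmod (x k + y k))\<^sup>2) \<le> (X + Y)\<^sup>2"
    by (rule suminf_le_const[OF s part])
  then have "sqrt (\<Sum>k. w k * (cmod (x k + y k))\<^sup>2) \<le> X + Y"
    using pos by (simp add: real_le_lsqrt)
  then show "sqrt (\<Sum>k. w k * (cmod (x k + y k))\<^sup>2) \<le>
      sqrt (\<Sum>k. w k * (cmod (x k))\<^sup>2) + sqrt (\<Sum>k. w k * (cmod (y k))\<^sup>2)"
    by (simp add: X_def Y_def)
qed

lemma dirichlet_space_diff: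
  assumes "a \<in> dirichlet_space" "b \<in> dirichlet_space"
  shows "(\<lambda>z. a z - b z) \<in> dirichlet_space"
proof -
  have "summable (\<lambda>k. real (k + 1) * (cmod (taylor_coeff a k + - taylor_coeff b k))\<^sup>2)"
    using assms by (intro weighted_l2_triangle) (auto simp: dirichlet_space_def)
  then show ?thesis
    using assms by (auto simp: dirichlet_space_def taylor_coeff_diff intro!: holomorphic_intros)
qed

lemma dirichlet_norm_triangle:
  assumes "a \<in> dirichlet_space" "b \<in> dirichlet_space" "c \<in> dirichlet_space"
  shows "dirichlet_norm (\<lambda>z. a z - c z) \<le>
    dirichlet_norm (\<lambda>z. a z - b z) + dirichlet_norm (\<lambda>z. b z - c z)"
proof -
  have hol: "a holomorphic_on ball 0 1" "b holomorphic_on ball 0 1" "c holomorphic_on ball 0 1"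
    using assms by (auto simp: dirichlet_space_def)
  have *: "taylor_coeff (\<lambda>z. a z - c z) k =
      taylor_coeff (\<lambda>z. a z - b z) k + taylor_coeff (\<lambda>z. b z - c z) k" for k
    using hol by (simp add: taylor_coeff_diff)
  show ?thesis
    unfolding dirichlet_norm_def *
    by (rule weighted_l2_triangle)
      (use dirichlet_space_diff[OF assms(1,2)] dirichlet_space_diff[OF assms(2,3)]
        in \<open>auto simp: dirichlet_space_def\<close>)
qed

text \<open>Parseval for \<open>deriv h\<close> on the unit circle gives summability with the
  weights \<open>k\<^sup>2\<close>, and \<open>k + 1 \<le> 2 * k\<^sup>2\<close> for
  \<open>k \<ge> 1\<close>.\<close>

lemma holomorphic_imp_dirichlet_space:
  assumes h: "h holomorphic_on ball 0 R" and R: "1 < R"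
  shows "h \<in> dirichlet_space"
proof -
  have "summable (\<lambda>k. (cmod (taylor_coeff (deriv h) k))\<^sup>2)"
    using summable_taylor_coeff_power2[OF holomorphic_deriv[OF h] R] by simp
  then have s: "summable (\<lambda>k. 2 * (real (Suc k) * cmod (taylor_coeff h (Suc k)))\<^sup>2)"
    by (intro summable_mult) (simp add: taylor_coeff_deriv norm_mult del: of_nat_Suc)
  have "summable (\<lambda>k. real (Suc k + 1) * (cmod (taylor_coeff h (Suc k)))\<^sup>2)"
  proof (rule summable_comparison_test'[OF s, where N = 0])
    fix k
    have "real (Suc k + 1) \<le> 2 * (real (Suc k))\<^sup>2"
      by (simp add: power2_eq_square algebra_simps)
    then show "norm (real (Suc k + 1) * (cmod (taylor_coeff h (Suc k)))\<^sup>2) \<le>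
        2 * (real (Suc k) * cmod (taylor_coeff h (Suc k)))\<^sup>2"
      by (simp add: power_mult_distrib mult_right_mono flip: mult.assoc)
  qed
  then have "summable (\<lambda>k. real (k + 1) * (cmod (taylor_coeff h k))\<^sup>2)"
    by (subst (asm) summable_Suc_iff)
  moreover have "h holomorphic_on ball 0 1"
    using R by (intro holomorphic_on_subset[OF h]) auto
  ultimately show ?thesis by (simp add: dirichlet_space_def)
qed

lemma dirichlet_norm_power2:
  assumes "h \<in> dirichlet_space"
  shows "(dirichlet_norm h)\<^sup>2 = (\<Sum>k. real (k + 1) * (cmod (taylor_coeff h k))\<^sup>2)"
  using assms by (auto simp: dirichlet_norm_def dirichlet_space_def intro!: suminf_nonneg)

lemma dirichlet_norm_nonneg:
  assumes "h \<in> dirichlet_space"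
  shows "0 \<le> dirichlet_norm h"
  using assms by (auto simp: dirichlet_norm_def dirichlet_space_def intro!: suminf_nonneg)

text \<open>A potential of small norm is thus small at the centre although its real part is at least
  1 on \<open>E\<close>. This contrast drives the approximation of \<open>cnj\<close> and rules out
  the full circle.\<close>

lemma cmod_0_le_dirichlet_norm:
  assumes "h \<in> dirichlet_space"
  shows "cmod (h 0) \<le> dirichlet_norm h"
proof -
  have "(cmod (h 0))\<^sup>2 \<le> (\<Sum>k. real (k + 1) * (cmod (taylor_coeff h k))\<^sup>2)"
    using sum_le_suminf[of "\<lambda>k. real (k + 1) * (cmod (taylor_coeff h k))\<^sup>2" "{0}"] assms
    by (auto simp: dirichlet_space_def taylor_coeff_def)
  then show ?thesis
    unfolding dirichlet_norm_def by (simp add: real_le_rsqrt)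
qed

text \<open>Up to a factor 2, the squared Dirichlet norm is \<open>|h 0|\<^sup>2\<close> plus the
  squared Bergman norm of \<open>deriv h\<close>, since \<open>k \<le> k + 1 \<le> 2 * k\<close> for
  \<open>k \<ge> 1\<close>; and the Bergman norm respects pointwise bounds. The factor 3 is the root
  of 1 + 4 + 4: one \<open>C\<^sup>2 * U\<close> from the value at 0, four from \<open>u\<close> and
  four from \<open>deriv u\<close>.\<close>

lemma dirichlet_norm_dominated:
  assumes u: "u holomorphic_on ball 0 R" and v: "v holomorphic_on ball 0 R" and R: "1 < R"
    and C: "0 \<le> C"
    and le: "\<And>z. z \<in> cball 0 1 \<Longrightarrow> cmod (v z) \<le> C * cmod (u z)"
    and le': "\<And>z. z \<in> cball 0 1 \<Longrightarrow> cmod (deriv v z) \<le> C * (cmod (u z) + cmod (deriv u z))"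
  shows "dirichlet_norm v \<le> 3 * C * dirichlet_norm u"
proof -
  define q where "q h k = (cmod (taylor_coeff h k))\<^sup>2" for h k
  note D = holomorphic_imp_dirichlet_space[OF u R] holomorphic_imp_dirichlet_space[OF v R]
  have su: "summable (\<lambda>k. real (k + 1) * q u k)" and sv: "summable (\<lambda>k. real (k + 1) * q v k)"
    using D by (auto simp: dirichlet_space_def q_def)
  define U where "U = (\<Sum>k. real (k + 1) * q u k)"
  have q_nonneg: "0 \<le> q h k" for h k by (simp add: q_def)
  \<comment> \<open>The Bergman weight cancels one of the two factors \<open>k + 1\<close> produced
    by squaring the coefficient of the derivative.\<close>
  have q_deriv: "q (deriv h) k / real (Suc k) = real (Suc k) * q h (Suc k)" for h k
    by (simp add: q_def taylor_coeff_deriv norm_mult power_mult_distrib power2_eq_square del: of_nat_Suc)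
  have "(\<Sum>k. q (deriv v) k / real (Suc k)) \<le>
      2 * C\<^sup>2 * (\<Sum>k. q u k / real (Suc k)) + 2 * C\<^sup>2 * (\<Sum>k. q (deriv u) k / real (Suc k))"
    unfolding q_def
  proof (rule bergman_norm_mono[OF holomorphic_deriv[OF v] u holomorphic_deriv[OF u] R])
    fix z :: complex assume z: "z \<in> cball 0 1"
    have "(cmod (deriv v z))\<^sup>2 \<le> (C * (cmod (u z) + cmod (deriv u z)))\<^sup>2"
      using le'[OF z] by (intro power_mono) auto
    also have "\<dots> = C\<^sup>2 * (cmod (u z) + cmod (deriv u z))\<^sup>2"
      by (simp add: power_mult_distrib)
    also have "\<dots> \<le> C\<^sup>2 * (2 * (cmod (u z))\<^sup>2 + 2 * (cmod (deriv u z))\<^sup>2)"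
      using sum_squares_bound[of "cmod (u z)" "cmod (deriv u z)"]
      by (intro mult_left_mono) (auto simp: power2_sum)
    finally show "(cmod (deriv v z))\<^sup>2 \<le> 2 * C\<^sup>2 * (cmod (u z))\<^sup>2 + 2 * C\<^sup>2 * (cmod (deriv u z))\<^sup>2"
      by (simp add: algebra_simps)
  qed auto
  moreover have "(\<Sum>k. q u k / real (Suc k)) \<le> U"
  proof -
    have le: "q u k / real (Suc k) \<le> real (k + 1) * q u k" for k
    proof -
      have "q u k / real (Suc k) \<le> q u k"
        using frac_le[of "q u k" "q u k" 1 "real (Suc k)"] q_nonneg[of u k] by simp
      also have "\<dots> \<le> real (k + 1) * q u k"
        using mult_right_mono[OF _ q_nonneg[of u k], of 1 "real (k + 1)"] by simp
      finally show ?thesis .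
    qed
    have "summable (\<lambda>k. q u k / real (Suc k))"
      by (rule summable_comparison_test'[OF su, where N = 0]) (use le q_nonneg in auto)
    then show ?thesis unfolding U_def by (intro suminf_le le su)
  qed
  moreover have tail: "(\<Sum>k. real (Suc k) * q h (Suc k)) \<le> (\<Sum>k. real (k + 1) * q h k) - q h 0"
      "(\<Sum>k. real (k + 1) * q h k) \<le> q h 0 + 2 * (\<Sum>k. real (Suc k) * q h (Suc k))"
    if s: "summable (\<lambda>k. real (k + 1) * q h k)" for h
  proof -
    have s1: "summable (\<lambda>k. real (Suc k + 1) * q h (Suc k))"
      using s by (subst summable_Suc_iff)
    have s2: "summable (\<lambda>k. real (Suc k) * q h (Suc k))"
      by (rule summable_comparison_test'[OF s1, where N = 0]) (use q_nonneg in \<open>auto intro: mult_right_mono\<close>)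
    have split: "(\<Sum>k. real (k + 1) * q h k) = (\<Sum>k. real (Suc k + 1) * q h (Suc k)) + q h 0"
      using suminf_split_head[OF s] by simp
    have "(\<Sum>k. real (Suc k) * q h (Suc k)) \<le> (\<Sum>k. real (Suc k + 1) * q h (Suc k))"
      by (intro suminf_le s1 s2 mult_right_mono q_nonneg) auto
    then show "(\<Sum>k. real (Suc k) * q h (Suc k)) \<le> (\<Sum>k. real (k + 1) * q h k) - q h 0"
      using split by linarith
    have "(\<Sum>k. real (Suc k + 1) * q h (Suc k)) \<le> (\<Sum>k. 2 * (real (Suc k) * q h (Suc k)))"
    proof (rule suminf_le[OF _ s1 summable_mult[OF s2]])
      show "real (Suc k + 1) * q h (Suc k) \<le> 2 * (real (Suc k) * q h (Suc k))" for k
        unfolding mult.assoc[symmetric] by (intro mult_right_mono q_nonneg) auto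
    qed
    then show "(\<Sum>k. real (k + 1) * q h k) \<le> q h 0 + 2 * (\<Sum>k. real (Suc k) * q h (Suc k))"
      using suminf_mult[OF s2, of 2] split by linarith
  qed
  moreover have "q v 0 \<le> C\<^sup>2 * q u 0"
    using power_mono[OF le[of 0], of 2] by (simp add: q_def taylor_coeff_def power_mult_distrib)
  moreover have "C\<^sup>2 * q u 0 \<le> C\<^sup>2 * U" "C\<^sup>2 * (\<Sum>k. real (Suc k) * q u (Suc k)) \<le> C\<^sup>2 * U"
    "C\<^sup>2 * (\<Sum>k. q u k / real (Suc k)) \<le> C\<^sup>2 * U"
  proof -
    have "0 \<le> (\<Sum>k. real (Suc k) * q u (Suc k))"
      by (intro suminf_nonneg summable_comparison_test'[where N = 0 and f = "\<lambda>k. real (Suc k) * q u (Suc k)"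
         and g = "\<lambda>k. real (Suc k + 1) * q u (Suc k)"])
       (use q_nonneg su summable_Suc_iff[of "\<lambda>k. real (k + 1) * q u k"] in \<open>auto intro: mult_right_mono\<close>)
    then show "C\<^sup>2 * q u 0 \<le> C\<^sup>2 * U" "C\<^sup>2 * (\<Sum>k. real (Suc k) * q u (Suc k)) \<le> C\<^sup>2 * U"
      using tail(1)[OF su] q_nonneg[of u 0] unfolding U_def[symmetric]
      by (auto intro!: mult_left_mono)
    show "C\<^sup>2 * (\<Sum>k. q u k / real (Suc k)) \<le> C\<^sup>2 * U"
      by (intro mult_left_mono \<open>(\<Sum>k. q u k / real (Suc k)) \<le> U\<close>) auto
  qed
  ultimately have "(\<Sum>k. real (k + 1) * q v k) \<le> 9 * (C\<^sup>2 * U)"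
    using tail(2)[OF sv] unfolding q_deriv by linarith
  then have "(dirichlet_norm v)\<^sup>2 \<le> (3 * C * dirichlet_norm u)\<^sup>2"
    using D by (simp add: dirichlet_norm_power2 power_mult_distrib U_def q_def)
  then show ?thesis
    by (rule power2_le_imp_le) (use C dirichlet_norm_nonneg[OF D(1)] in simp)
qed

section \<open>Approximation in the Dirichlet norm by Taylor polynomials and dilations\<close>

text \<open>The squared norm of the remainder is the tail of the convergent series of
  \<open>h\<close>; uniform convergence on the closed disc follows from absolute summability of the
  coefficients.\<close>

lemma taylor_polynomials_converge:
  assumes h: "h holomorphic_on ball 0 R" and R: "1 < R"
  defines "P \<equiv> \<lambda>n. \<Sum>k<n. monom (taylor_coeff h k) k"
  shows "uniform_limit (cball 0 1) (\<lambda>n. poly (P n)) h sequentially"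
    and "(\<lambda>n. dirichlet_norm (\<lambda>z. poly (P n) z - h z)) \<longlonglongrightarrow> 0"
proof -
  have poly: "poly (P n) z = (\<Sum>k<n. taylor_coeff h k * z ^ k)" for n z
    by (simp add: P_def poly_sum poly_monom)
  have hol1: "h holomorphic_on ball 0 1"
    using R by (intro holomorphic_on_subset[OF h]) auto
  have sm: "summable (\<lambda>k. cmod (taylor_coeff h k))"
    using taylor_coeff_summable_norm[OF h, of 1] R by simp
  have "uniform_limit (cball 0 1) (\<lambda>n z. \<Sum>k<n. taylor_coeff h k * z ^ k)
      (\<lambda>z. \<Sum>k. taylor_coeff h k * z ^ k) sequentially"
    by (rule Weierstrass_m_test[OF _ sm])
      (auto simp: norm_mult norm_power intro!: mult_left_le power_le_one)
  moreover have "(\<Sum>k. taylor_coeff h k * z ^ k) = h z" if "z \<in> cball 0 1" for z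
    using taylor_coeff_sums[OF h, of z] that R by (simp add: sums_iff)
  ultimately show "uniform_limit (cball 0 1) (\<lambda>n. poly (P n)) h sequentially"
    unfolding poly[abs_def] by (subst (asm) uniform_limit_cong'[OF refl]) auto
  define c where "c k = real (k + 1) * (cmod (taylor_coeff h k))\<^sup>2" for k
  have sc: "summable c"
    using holomorphic_imp_dirichlet_space[OF h R] by (simp add: dirichlet_space_def c_def[abs_def])
  have tc: "taylor_coeff (poly (P n)) k = (if k < n then taylor_coeff h k else 0)" for n k
  proof (rule taylor_coeff_eqI[of 1])
    fix z :: complex
    have "(\<lambda>k. if k \<in> {..<n} then taylor_coeff h k * z ^ k else 0) sums poly (P n) z"
      unfolding poly by (rule sums_If_finite_set) simp
    then show "(\<lambda>k. (if k < n then taylor_coeff h k else 0) * z ^ k) sums poly (P n) z"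
      by (simp add: if_distrib[of "\<lambda>x. x * _"] cong: if_cong)
  qed (auto intro!: holomorphic_intros)
  have "dirichlet_norm (\<lambda>z. poly (P n) z - h z) = sqrt (suminf c - (\<Sum>k<n. c k))" for n
  proof -
    have "real (k + 1) * (cmod (taylor_coeff (\<lambda>z. poly (P n) z - h z) k))\<^sup>2 =
        c k - (if k \<in> {..<n} then c k else 0)" for k
      by (subst taylor_coeff_diff[OF _ hol1]) (auto simp: tc c_def intro!: holomorphic_intros)
    moreover have "(\<lambda>k. c k - (if k \<in> {..<n} then c k else 0)) sums (suminf c - (\<Sum>k<n. c k))"
      by (intro sums_diff summable_sums[OF sc] sums_If_finite_set) simp
    ultimately show ?thesis
      by (simp add: dirichlet_norm_def sums_iff)
  qed
  moreover have "(\<lambda>n. sqrt (suminf c - (\<Sum>k<n. c k))) \<longlonglongrightarrow> sqrt (suminf c - suminf c)"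
    by (intro tendsto_intros summable_LIMSEQ sc)
  ultimately show "(\<lambda>n. dirichlet_norm (\<lambda>z. poly (P n) z - h z)) \<longlonglongrightarrow> 0"
    by simp
qed

text \<open>Dilation multiplies the coefficient of index \<open>k\<close> by \<open>r ^ k\<close>.
  The summands of the squared norm thus acquire factors \<open>(1 - r ^ k)\<^sup>2 \<le> 1\<close>
  tending to 0, and Tannery's theorem, with the Dirichlet series of \<open>g\<close> as majorant,
  exchanges limit and sum.\<close>

lemma dirichlet_norm_dilation_tendsto_0:
  assumes g: "g \<in> dirichlet_space"
  shows "((\<lambda>r. dirichlet_norm (\<lambda>z. g (of_real r * z) - g z)) \<longlongrightarrow> 0) (at_left (1::real))"
proof -
  have hol: "g holomorphic_on ball 0 1" and sg: "summable (\<lambda>k. real (k + 1) * (cmod (taylor_coeff g k))\<^sup>2)"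
    using g by (auto simp: dirichlet_space_def)
  define a where "a k r = real (k + 1) * (cmod (taylor_coeff g k))\<^sup>2 * (1 - r ^ k)\<^sup>2" for k and r :: real
  have ev: "eventually (\<lambda>r::real. 0 < r \<and> r < 1) (at_left 1)"
    using eventually_at_left_real[of 0 "1::real"] by simp
  have tan: "((\<lambda>r. \<Sum>k. a k r) \<longlongrightarrow> (\<Sum>k::nat. 0)) (at_left 1)"
  proof (rule tannerys_theorem[THEN conjunct2, THEN conjunct2])
    show "((\<lambda>r. a k r) \<longlongrightarrow> 0) (at_left 1)" for k
    proof -
      have "(a k \<longlongrightarrow> real (k + 1) * (cmod (taylor_coeff g k))\<^sup>2 * (1 - 1 ^ k)\<^sup>2) (at_left 1)"
        unfolding a_def[abs_def] by (intro tendsto_intros)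
      then show ?thesis by simp
    qed
    have "eventually (\<lambda>(k::nat, r::real). True \<and> (0 < r \<and> r < 1)) (sequentially \<times>\<^sub>F at_left 1)"
      using eventually_prodI[OF always_eventually[of "\<lambda>_. True" sequentially] ev]
      by (simp add: case_prod_unfold)
    then show "eventually (\<lambda>(k, r). norm (a k r) \<le> real (k + 1) * (cmod (taylor_coeff g k))\<^sup>2) (sequentially \<times>\<^sub>F at_left 1)"
    proof eventually_elim
      case (elim x)
      obtain k r where x: "x = (k, r)" by force
      have "0 \<le> r ^ k" "r ^ k \<le> 1" using elim x by (auto intro!: power_le_one)
      then have "(1 - r ^ k)\<^sup>2 \<le> 1" by (intro power_le_one) auto
      then show ?case
        by (simp add: x a_def abs_mult mult_left_le)
    qed
  qed (use sg in auto)
  have "eventually (\<lambda>r. dirichlet_norm (\<lambda>z. g (of_real r * z) - g z) = sqrt (\<Sum>k. a k r)) (at_left 1)"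
    using ev
  proof eventually_elim
    case (elim r)
    have sub: "cmod (of_real r * z) < 1" if "cmod z < 1" for z
      using elim that mult_strict_mono[of r 1 "cmod z" 1] by (simp add: norm_mult)
    have hol': "(\<lambda>z. g (of_real r * z)) holomorphic_on ball 0 1"
      by (rule holomorphic_on_compose_gen[OF _ hol, of "\<lambda>z. of_real r * z", unfolded o_def])
        (use sub in \<open>auto intro!: holomorphic_intros\<close>)
    have "taylor_coeff (\<lambda>z. g (of_real r * z)) k = taylor_coeff g k * of_real r ^ k" for k
    proof (rule taylor_coeff_eqI[of 1, OF _ hol'])
      fix z :: complex assume "cmod z < 1"
      from taylor_coeff_sums[OF hol sub[OF this]]
      show "(\<lambda>k. taylor_coeff g k * of_real r ^ k * z ^ k) sums g (of_real r * z)"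
        by (simp add: power_mult_distrib mult.assoc)
    qed simp
    then have *: "taylor_coeff (\<lambda>z. g (of_real r * z) - g z) k = - of_real (1 - r ^ k) * taylor_coeff g k" for k
      unfolding taylor_coeff_diff[OF hol' hol] by (simp add: left_diff_distrib right_diff_distrib mult.commute)
    show ?case
      unfolding dirichlet_norm_def a_def * norm_mult norm_minus_cancel norm_of_real
      by (simp add: power_mult_distrib mult_ac)
  qed
  moreover have "((\<lambda>r. sqrt (\<Sum>k. a k r)) \<longlongrightarrow> sqrt (\<Sum>k::nat. 0)) (at_left 1)"
    by (intro tendsto_intros tan)
  ultimately show ?thesis
    using tendsto_cong by fastforce
qed

section \<open>Fekete points\<close>

text \<open>On the unit circle \<open>|1 - z * cnj w| = |z - w|\<close>, so \<open>r = 1\<close>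
  gives the logarithmic kernel off the diagonal. For \<open>0 < r < 1\<close> and \<open>w\<close>
  on the circle the kernel is finite on the diagonal and harmonic in \<open>z\<close> for
  \<open>|z| < 1 / r\<close>.\<close>

definition dilated_kernel :: "real \<Rightarrow> complex \<Rightarrow> complex \<Rightarrow> real" where
  "dilated_kernel r z w = - ln (cmod (1 - of_real r * z * cnj w))"

lemma dilated_kernel_commute: "dilated_kernel r z w = dilated_kernel r w z"
proof -
  have "cmod (1 - of_real r * w * cnj z) = cmod (cnj (1 - of_real r * z * cnj w))"
    by (simp add: mult_ac)
  then show ?thesis by (simp only: dilated_kernel_def complex_mod_cnj)
qed

text \<open>The term with index 0 is \<open>1 / 0 = 0\<close>.\<close>

lemma neg_Ln_sums:
  assumes "cmod z < 1"
  shows "(\<lambda>k. z ^ k / of_nat k) sums (- Ln (1 - z))"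
  using sums_minus[OF Ln_series'[of "- z"]] assms by simp

lemma Re_neg_Ln:
  assumes "cmod z < 1"
  shows "Re (- Ln (1 - z)) = - ln (cmod (1 - z))"
  using assms by (subst uminus_complex.simps, subst Re_Ln) auto

lemma dilated_kernel_sums:
  assumes "0 \<le> r" "r < 1" "cmod z = 1" "cmod w = 1"
  shows "(\<lambda>k. r ^ k / real k * Re (z ^ k * cnj (w ^ k))) sums dilated_kernel r z w"
proof -
  have n: "cmod (of_real r * z * cnj w) < 1" using assms by (simp add: norm_mult)
  have "(\<lambda>k. Re ((of_real r * z * cnj w) ^ k / of_nat k)) sums dilated_kernel r z w"
    using sums_Re[OF neg_Ln_sums[OF n]] unfolding Re_neg_Ln[OF n] by (simp add: dilated_kernel_def)
  moreover have "Re ((of_real r * z * cnj w) ^ k / of_nat k) = r ^ k / real k * Re (z ^ k * cnj (w ^ k))" for k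
  proof -
    have "(of_real r * z * cnj w) ^ k / of_nat k = of_real (r ^ k / real k) * (z ^ k * cnj (w ^ k))"
      by (simp add: power_mult_distrib)
    moreover have "Re (of_real c * v) = c * Re v" for c v by simp
    ultimately show ?thesis by (simp only:)
  qed
  ultimately show ?thesis by (simp only:)
qed

text \<open>Positive definiteness of the kernel: summing \<open>Re (x i ^ k * cnj (x j ^ k))\<close>
  over all pairs, diagonal included, gives a perfect square. The energy becomes a weighted sum of
  squared moments, the form in which it is compared with the Dirichlet norm and passed to weak
  limits.\<close>

lemma dilated_energy_sums:
  assumes r: "0 \<le> r" "r < 1" and x: "\<And>i. i < n \<Longrightarrow> cmod (x i) = 1"
  shows "(\<lambda>k. r ^ k / real k * (cmod (\<Sum>i<n. x i ^ k))\<^sup>2) sums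
    (\<Sum>i<n. \<Sum>j<n. dilated_kernel r (x i) (x j))"
proof -
  have "(\<lambda>k. \<Sum>i<n. \<Sum>j<n. r ^ k / real k * Re (x i ^ k * cnj (x j ^ k))) sums
      (\<Sum>i<n. \<Sum>j<n. dilated_kernel r (x i) (x j))"
    by (intro sums_sum dilated_kernel_sums r x) auto
  moreover have "(\<Sum>i<n. \<Sum>j<n. r ^ k / real k * Re (x i ^ k * cnj (x j ^ k))) =
      r ^ k / real k * (cmod (\<Sum>i<n. x i ^ k))\<^sup>2" for k
  proof -
    have "(cmod (\<Sum>i<n. x i ^ k))\<^sup>2 = Re ((\<Sum>i<n. x i ^ k) * cnj (\<Sum>i<n. x i ^ k))"
      by (simp only: complex_norm_square[symmetric] Re_complex_of_real)
    also have "\<dots> = (\<Sum>i<n. \<Sum>j<n. Re (x i ^ k * cnj (x j ^ k)))"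
      by (simp only: cnj_sum sum_product Re_sum)
    finally show ?thesis by (simp only: sum_distrib_left)
  qed
  ultimately show ?thesis by simp
qed

text \<open>The point \<open>i\<close> occurs in one row and one column of a symmetric pair energy,
  whence the factor 2; the remaining sum does not involve \<open>i\<close> and cancels when only
  that point is moved.\<close>

lemma sum_off_diagonal_remove:
  fixes K :: "nat \<Rightarrow> nat \<Rightarrow> real"
  assumes "finite A" "i \<in> A" "\<And>j k. K j k = K k j"
  shows "(\<Sum>k\<in>A. \<Sum>j\<in>A - {k}. K k j) =
    2 * (\<Sum>j\<in>A - {i}. K i j) + (\<Sum>k\<in>A - {i}. \<Sum>j\<in>A - {i} - {k}. K k j)"
proof -
  have "(\<Sum>k\<in>A. \<Sum>j\<in>A - {k}. K k j) =
      (\<Sum>j\<in>A - {i}. K i j) + (\<Sum>k\<in>A - {i}. \<Sum>j\<in>A - {k}. K k j)"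
    by (rule sum.remove) fact+
  also have "(\<Sum>k\<in>A - {i}. \<Sum>j\<in>A - {k}. K k j) = (\<Sum>k\<in>A - {i}. K k i + (\<Sum>j\<in>A - {i} - {k}. K k j))"
  proof (rule sum.cong[OF refl])
    fix k assume "k \<in> A - {i}"
    then have "(\<Sum>j\<in>A - {k}. K k j) = K k i + (\<Sum>j\<in>A - {k} - {i}. K k j)"
      using assms by (intro sum.remove) auto
    moreover have "A - {k} - {i} = A - {i} - {k}" by blast
    ultimately show "(\<Sum>j\<in>A - {k}. K k j) = K k i + (\<Sum>j\<in>A - {i} - {k}. K k j)" by simp
  qed
  finally show ?thesis
    using assms(3) by (simp add: sum.distrib)
qed

text \<open>Fekete points for the dilated kernel: at a minimiser of the off-diagonal energy no single point
  can be moved to decrease the energy, and averaging these inequalities over all points bounds the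
  potential from below on all of \<open>E\<close> by the mean energy \<open>V\<close>.\<close>

lemma fekete_points:
  assumes E: "compact E" "E \<noteq> {}" "E \<subseteq> sphere 0 1" and r: "0 \<le> r" "r < 1" and n: "2 \<le> n"
  obtains x :: "nat \<Rightarrow> complex" and V :: real
  where "\<And>i. x i \<in> E"
    and "\<And>z. z \<in> E \<Longrightarrow> real n * V \<le> (\<Sum>j<n. dilated_kernel r z (x j))"
    and "(\<Sum>i<n. \<Sum>j<n. dilated_kernel r (x i) (x j)) = real n * (real n - 1) * V - real n * ln (1 - r)"
proof -
  let ?K = "dilated_kernel r"
  define \<Phi> where "\<Phi> x = (\<Sum>i<n. \<Sum>j\<in>{..<n} - {i}. ?K (x i) (x j))" for x
  \<comment> \<open>Configurations are indexed by all naturals, so that \<open>X\<close> is compact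
    in the product topology by Tychonoff's theorem.\<close>
  define X where "X = {x :: nat \<Rightarrow> complex. \<forall>i. x i \<in> E}"
  have X_PiE: "X = (Pi\<^sub>E UNIV (\<lambda>_. E))"
    by (auto simp: X_def PiE_def Pi_def)
  have "compactin (product_topology (\<lambda>_::nat. euclidean) UNIV) X"
    unfolding X_PiE by (subst compactin_PiE) (use E in auto)
  then have "compact X" by (simp add: euclidean_product_topology)
  moreover have "X \<noteq> {}" using E(2) by (auto simp: X_def)
  moreover have "continuous_on X \<Phi>"
  proof -
    have nz: "1 - of_real r * x i * cnj (x j) \<noteq> 0" if "x \<in> X" for x i j
    proof -
      have "cmod (x i) = 1" "cmod (x j) = 1" using that E(3) by (auto simp: X_def)
      then have "cmod (of_real r * x i * cnj (x j)) < 1" using r by (simp add: norm_mult)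
      then show ?thesis by auto
    qed
    have [continuous_intros]: "continuous_on X (\<lambda>x. x i)" for i
      by (rule continuous_on_subset[OF continuous_on_product_coordinates]) simp
    show ?thesis
      unfolding \<Phi>_def dilated_kernel_def
      by (intro continuous_intros) (use nz in auto)
  qed
  ultimately obtain x where x: "x \<in> X" "\<And>y. y \<in> X \<Longrightarrow> \<Phi> x \<le> \<Phi> y"
    using continuous_attains_inf[of X \<Phi>] by blast
  have xE: "x i \<in> E" for i using x(1) by (auto simp: X_def)
  have min: "(\<Sum>j\<in>{..<n} - {i}. ?K (x i) (x j)) \<le> (\<Sum>j\<in>{..<n} - {i}. ?K z (x j))"
    if "z \<in> E" "i < n" for z i
  proof -
    define y where "y = x(i := z)"
    have "y \<in> X" using x(1) that by (auto simp: X_def y_def)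
    have remove: "\<Phi> x = 2 * (\<Sum>j\<in>{..<n} - {i}. ?K (x i) (x j)) +
        (\<Sum>k\<in>{..<n} - {i}. \<Sum>j\<in>{..<n} - {i} - {k}. ?K (x k) (x j))" for x
      unfolding \<Phi>_def using that by (intro sum_off_diagonal_remove dilated_kernel_commute) auto
    have "\<Phi> x \<le> \<Phi> y" using \<open>y \<in> X\<close> by (rule x(2))
    moreover have "(\<Sum>k\<in>{..<n} - {i}. \<Sum>j\<in>{..<n} - {i} - {k}. ?K (y k) (y j)) =
        (\<Sum>k\<in>{..<n} - {i}. \<Sum>j\<in>{..<n} - {i} - {k}. ?K (x k) (x j))"
      by (intro sum.cong) (auto simp: y_def)
    moreover have "(\<Sum>j\<in>{..<n} - {i}. ?K (y i) (y j)) = (\<Sum>j\<in>{..<n} - {i}. ?K z (x j))"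
      by (intro sum.cong) (auto simp: y_def)
    ultimately show ?thesis using remove[of y] remove[of x] by linarith
  qed
  define V where "V = \<Phi> x / (real n * (real n - 1))"
  have V: "real n * (real n - 1) * V = \<Phi> x" using n by (simp add: V_def)
  show thesis
  proof
    show "x i \<in> E" for i by fact
    fix z assume z: "z \<in> E"
    have "\<Phi> x \<le> (\<Sum>i<n. \<Sum>j\<in>{..<n} - {i}. ?K z (x j))"
      unfolding \<Phi>_def by (rule sum_mono) (use min[OF z] in auto)
    \<comment> \<open>Each point is omitted from exactly one of the \<open>n\<close> sums, so the
      full potential is counted \<open>n - 1\<close> times.\<close>
    also have "\<dots> = (\<Sum>i<n. (\<Sum>j<n. ?K z (x j)) - ?K z (x i))"
      by (intro sum.cong refl) (simp add: sum_diff1)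
    also have "\<dots> = (real n - 1) * (\<Sum>j<n. ?K z (x j))"
      by (simp add: sum_subtractf left_diff_distrib)
    finally have "(real n - 1) * (real n * V) \<le> (real n - 1) * (\<Sum>j<n. ?K z (x j))"
      using V by (simp add: mult_ac)
    then show "real n * V \<le> (\<Sum>j<n. ?K z (x j))"
      using n by (subst (asm) mult_le_cancel_left_pos) auto
  next
    have diag: "?K (x i) (x i) = - ln (1 - r)" for i
    proof -
      have "x i * cnj (x i) = 1"
        using xE[of i] E(3) by (auto simp flip: complex_norm_square)
      then have "of_real r * x i * cnj (x i) = of_real r"
        by (simp add: mult.assoc)
      then have "1 - of_real r * x i * cnj (x i) = of_real (1 - r)"
        by simp
      then have "cmod (1 - of_real r * x i * cnj (x i)) = 1 - r"
        using r by (simp only: norm_of_real)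
      then show ?thesis by (simp add: dilated_kernel_def)
    qed
    have "(\<Sum>i<n. \<Sum>j<n. ?K (x i) (x j)) = (\<Sum>i<n. (\<Sum>j\<in>{..<n} - {i}. ?K (x i) (x j)) + ?K (x i) (x i))"
      by (intro sum.cong refl) (simp add: sum_diff1)
    also have "\<dots> = \<Phi> x - real n * ln (1 - r)"
      by (simp add: sum.distrib sum_subtractf diag \<Phi>_def)
    finally show "(\<Sum>i<n. \<Sum>j<n. ?K (x i) (x j)) = real n * (real n - 1) * V - real n * ln (1 - r)"
      by (simp add: V)
  qed
qed

section \<open>Logarithmic energy of weak limits\<close>

text \<open>As \<open>exp\<close> is positive, capacity 0 means an infinite Robin constant and hence
  infinite energy of every \<open>\<mu>\<close>. An extended difference is \<infinity> only if its
  first term is \<infinity> or its second is -\<infinity>, and the negative part, being nonnegative,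
  excludes the latter.\<close>

lemma nn_integral_log_kernel_pos_eq_infinity:
  assumes "log_capacity E = 0" "\<mu> \<in> prob_measures_on E"
  shows "(\<integral>\<^sup>+ p. log_kernel_pos (fst p) (snd p) \<partial>(\<mu> \<Otimes>\<^sub>M \<mu>)) = \<infinity>"
proof -
  have "robin_constant E = \<infinity>"
    using assms(1) by (auto simp: log_capacity_def split: if_splits)
  then have "log_energy \<mu> = \<infinity>"
    using INF_lower[OF assms(2), of log_energy] by (simp add: robin_constant_def)
  then have "enn2ereal (\<integral>\<^sup>+ p. log_kernel_pos (fst p) (snd p) \<partial>(\<mu> \<Otimes>\<^sub>M \<mu>)) = \<infinity>"
    unfolding log_energy_def
    using enn2ereal_nonneg[of "\<integral>\<^sup>+ p. log_kernel_neg (fst p) (snd p) \<partial>(\<mu> \<Otimes>\<^sub>M \<mu>)"]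
    by (subst (asm) ereal_minus_eq_PInfty_iff) auto
  then show ?thesis
    using enn2ereal_eq_top_iff by (simp add: infinity_ennreal_def)
qed

text \<open>The pointwise input for Fatou's lemma. The shift by \<open>ln 2\<close> offsets the
  lower bound \<open>- ln 2\<close> of the dilated kernels on the circle, so \<open>ennreal\<close>
  truncates nothing. On the diagonal the kernels are \<open>- ln (1 - \<rho> n)\<close> and tend to
  \<infinity>; off it they converge to the logarithmic kernel.\<close>

lemma log_kernel_pos_le_liminf:
  assumes "cmod z = 1" "cmod w = 1" "\<rho> \<longlonglongrightarrow> 1" "\<And>n. 0 \<le> \<rho> n" "\<And>n. \<rho> n < (1::real)"
  shows "log_kernel_pos z w \<le> liminf (\<lambda>n. ennreal (dilated_kernel (\<rho> n) z w + ln 2))"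
proof (cases "z = w")
  case True
  have "z * cnj w = 1"
    using assms True by (simp flip: complex_norm_square)
  then have "dilated_kernel (\<rho> n) z w = - ln (1 - \<rho> n)" for n
    using assms(5)[of n] norm_of_real[of "1 - \<rho> n", where 'a = complex]
    by (simp add: dilated_kernel_def mult.assoc)
  moreover have "filterlim (\<lambda>n. - ln (1 - \<rho> n) + ln 2) at_top sequentially"
  proof -
    have "filterlim (\<lambda>n. 1 - \<rho> n) (at_right 0) sequentially"
      unfolding filterlim_at using assms(3,5) by (auto intro!: tendsto_eq_intros always_eventually simp: less_imp_neq)
    then have "filterlim (\<lambda>n. ln (1 - \<rho> n)) at_bot sequentially"
      by (rule filterlim_compose[OF ln_at_0])
    then have "filterlim (\<lambda>n. - ln (1 - \<rho> n)) at_top sequentially"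
      by (simp add: filterlim_uminus_at_top)
    then show ?thesis
      by (subst add.commute, intro filterlim_tendsto_add_at_top[OF tendsto_const])
  qed
  ultimately have "(\<lambda>n. ennreal (dilated_kernel (\<rho> n) z w + ln 2)) \<longlonglongrightarrow> \<infinity>"
    by (simp add: ennreal_tendsto_top_eq_at_top)
  then show ?thesis
    using lim_imp_Liminf[of sequentially] by fastforce
next
  case False
  have "w * cnj w = 1" using assms by (simp flip: complex_norm_square)
  then have zw: "cmod (1 - z * cnj w) = cmod (z - w)"
    using assms(2) by (metis complex_mod_cnj left_diff_distrib mult.right_neutral norm_minus_commute norm_mult)
  have "(\<lambda>n. dilated_kernel (\<rho> n) z w + ln 2) \<longlonglongrightarrow> - ln (cmod (1 - of_real 1 * z * cnj w)) + ln 2"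
    unfolding dilated_kernel_def using assms(3) False zw by (intro tendsto_intros) auto
  then have "(\<lambda>n. ennreal (dilated_kernel (\<rho> n) z w + ln 2)) \<longlonglongrightarrow> ennreal (- ln (cmod (z - w)) + ln 2)"
    using zw by (intro tendsto_ennrealI) simp
  then have "liminf (\<lambda>n. ennreal (dilated_kernel (\<rho> n) z w + ln 2)) = ennreal (- ln (cmod (z - w)) + ln 2)"
    by (intro lim_imp_Liminf) auto
  moreover have "log_kernel_pos z w \<le> ennreal (- ln (cmod (z - w)) + ln 2)"
    using False by (auto simp: log_kernel_pos_def ln_div intro!: ennreal_leI)
  ultimately show ?thesis by simp
qed

lemma borel_measurable_cis [measurable]: "cis \<in> borel_measurable borel"
  by (intro borel_measurable_continuous_onI continuous_intros)

text \<open>By Fubini the double integral factors as \<open>c * cnj c\<close>.\<close>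

lemma (in real_distribution) has_bochner_integral_trig_product:
  fixes k :: nat
  defines "c \<equiv> (LINT t|M. cis (real k * t))"
  shows "has_bochner_integral (M \<Otimes>\<^sub>M M)
    (\<lambda>p. Re (cis (real k * fst p) * cnj (cis (real k * snd p)))) ((cmod c)\<^sup>2)"
proof -
  interpret P: pair_prob_space M M ..
  have [measurable]: "cnj \<in> borel_measurable borel"
    by (intro borel_measurable_continuous_onI continuous_intros)
  have int1: "integrable M (\<lambda>t. cis (real k * t))"
    by (rule integrable_const_bound[where B = 1]) auto
  have int: "integrable (M \<Otimes>\<^sub>M M) (\<lambda>p. cis (real k * fst p) * cnj (cis (real k * snd p)))"
    by (rule P.integrable_const_bound[where B = 1]) (auto simp: norm_mult)
  have "(LINT p|(M \<Otimes>\<^sub>M M). cis (real k * fst p) * cnj (cis (real k * snd p))) =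
      (LINT s|M. LINT t|M. cis (real k * s) * cnj (cis (real k * t)))"
    using P.integral_fst'[OF int] by simp
  also have "\<dots> = c * cnj c"
    using int1 by (simp add: c_def)
  finally have "has_bochner_integral (M \<Otimes>\<^sub>M M) (\<lambda>p. cis (real k * fst p) * cnj (cis (real k * snd p))) (c * cnj c)"
    using int by (simp add: has_bochner_integral_iff)
  from has_bochner_integral_bounded_linear[OF bounded_linear_Re this]
  show ?thesis
    by (simp only: complex_norm_square[symmetric] Re_complex_of_real)
qed

text \<open>The hypothesis bounds the energy in its Fourier form. Each dilated kernel lies within 1
  of a trigonometric polynomial whose double integral is a damped Fourier sum, hence at most
  \<open>B\<close>; Fatou's lemma for \<open>\<rho> n\<close> tending to 1 then bounds the positive
  part of the energy by \<open>B + 1 + ln 2\<close>.\<close>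

lemma (in real_distribution) log_energy_distr_cis_finite:
  assumes B: "\<And>n. (\<Sum>k<n. (cmod (LINT t|M. cis (real k * t)))\<^sup>2 / real k) \<le> B"
  defines "\<mu> \<equiv> distr M borel cis"
  shows "(\<integral>\<^sup>+ p. log_kernel_pos (fst p) (snd p) \<partial>(\<mu> \<Otimes>\<^sub>M \<mu>)) < \<infinity>"
proof -
  interpret P: pair_prob_space M M ..
  define c where "c k = (LINT t|M. cis (real k * t))" for k :: nat
  define \<rho> where "\<rho> n = 1 - inverse (real (n + 2))" for n
  have \<rho>: "0 \<le> \<rho> n" "\<rho> n < 1" for n
    by (auto simp: \<rho>_def field_simps)
  have "(\<lambda>n. 1 - inverse (real (n + 2))) \<longlonglongrightarrow> 1 - 0"
    by (intro tendsto_intros LIMSEQ_ignore_initial_segment[OF lim_inverse_n])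
  then have \<rho>_lim: "\<rho> \<longlonglongrightarrow> 1"
    by (simp add: \<rho>_def[abs_def])
  define T where "T n m s t = (\<Sum>k<m. \<rho> n ^ k / real k * Re (cis (real k * s) * cnj (cis (real k * t))))"
    for n m s t
  have "\<exists>m. \<forall>s t. \<bar>dilated_kernel (\<rho> n) (cis s) (cis t) - T n m s t\<bar> \<le> 1" for n
  proof -
    have geo: "summable (\<lambda>k. \<rho> n ^ k)"
      using \<rho>[of n] by (intro summable_geometric) auto
    \<comment> \<open>The terms of the kernel series are bounded by \<open>\<rho> n ^ k\<close>
      uniformly in \<open>s\<close> and \<open>t\<close>. A tail below the fixed constant 1 suffices
      because only finiteness of the energy is at stake.\<close>
    obtain m where m: "norm (\<Sum>k. \<rho> n ^ (k + m)) < 1"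
      using suminf_exist_split[OF _ geo, of 1] by auto
    have "\<bar>dilated_kernel (\<rho> n) (cis s) (cis t) - T n m s t\<bar> \<le> 1" for s t
    proof -
      define b where "b k = \<rho> n ^ k / real k * Re (cis (real k * s) * cnj (cis (real k * t)))" for k
      have b: "b sums dilated_kernel (\<rho> n) (cis s) (cis t)"
        using dilated_kernel_sums[OF \<rho>, of "cis s" "cis t"]
        by (simp only: b_def[abs_def] Complex.DeMoivre norm_cis)
      have bk: "norm (b k) \<le> \<rho> n ^ k" for k
      proof -
        have "\<bar>Re (cis (real k * s) * cnj (cis (real k * t)))\<bar> \<le> 1"
          using abs_Re_le_cmod[of "cis (real k * s) * cnj (cis (real k * t))"]
          by (simp only: norm_mult norm_cis complex_mod_cnj mult_1)
        then have "norm (b k) \<le> \<rho> n ^ k / real k * 1"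
          unfolding b_def norm_mult using \<rho>[of n] by (intro mult_mono) (auto simp: power_abs)
        also have "\<dots> \<le> \<rho> n ^ k"
          using \<rho>[of n] frac_le[of "\<rho> n ^ k" "\<rho> n ^ k" 1 "real k"] by (cases "k = 0") auto
        finally show ?thesis .
      qed
      have "dilated_kernel (\<rho> n) (cis s) (cis t) - T n m s t = (\<Sum>k. b (k + m))"
        unfolding T_def b_def[symmetric]
        using suminf_minus_initial_segment[OF sums_summable[OF b], of m] sums_unique[OF b] by simp
      also have "\<bar>\<dots>\<bar> \<le> (\<Sum>k. \<rho> n ^ (k + m))"
      proof -
        have s1: "summable (\<lambda>k. \<rho> n ^ (k + m))" using geo by (rule summable_ignore_initial_segment)
        have s2: "summable (\<lambda>k. norm (b (k + m)))"
          by (rule summable_comparison_test'[OF s1, where N = 0]) (use bk in auto)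
        have "norm (\<Sum>k. b (k + m)) \<le> (\<Sum>k. norm (b (k + m)))" by (rule summable_norm[OF s2])
        also have "\<dots> \<le> (\<Sum>k. \<rho> n ^ (k + m))" by (intro suminf_le s1 s2 bk)
        finally show ?thesis by simp
      qed
      finally show ?thesis using m by simp
    qed
    then show ?thesis by blast
  qed
  then obtain m where m: "\<And>n s t. \<bar>dilated_kernel (\<rho> n) (cis s) (cis t) - T n (m n) s t\<bar> \<le> 1"
    by metis
  \<comment> \<open>The 1 absorbs the truncation error and \<open>ln 2\<close> the lower bound of
    the kernel, so \<open>G n\<close> dominates the shifted kernel and is nonnegative.\<close>
  define G where "G n p = T n (m n) (fst p) (snd p) + 1 + ln 2" for n p
  have kernel_ge: "- ln 2 \<le> dilated_kernel (\<rho> n) (cis s) (cis t)" for n s t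
  proof -
    have "cmod (1 - of_real (\<rho> n) * cis s * cnj (cis t)) \<le> 1 + cmod (of_real (\<rho> n) * cis s * cnj (cis t))"
      using norm_triangle_ineq4[of 1 "of_real (\<rho> n) * cis s * cnj (cis t)"] by simp
    also have "\<dots> \<le> 2"
      using \<rho>[of n] by (simp add: norm_mult)
    finally have le2: "cmod (1 - of_real (\<rho> n) * cis s * cnj (cis t)) \<le> 2" .
    have "cmod (of_real (\<rho> n) * cis s * cnj (cis t)) < 1"
      using \<rho>[of n] by (simp add: norm_mult)
    then have "1 - of_real (\<rho> n) * cis s * cnj (cis t) \<noteq> 0"
      by auto
    then show ?thesis
      unfolding dilated_kernel_def using le2 by simp
  qed
  have G_ge: "dilated_kernel (\<rho> n) (cis s) (cis t) + ln 2 \<le> G n (s, t)" for n s t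
    using m[of n s t] by (simp add: G_def)
  have G_nonneg: "0 \<le> G n p" for n p
    using G_ge[of n "fst p" "snd p"] kernel_ge[of n "fst p" "snd p"] by simp
  have G_int: "has_bochner_integral (M \<Otimes>\<^sub>M M) (G n) ((\<Sum>k<m n. \<rho> n ^ k / real k * (cmod (c k))\<^sup>2) + 1 + ln 2)" for n
    unfolding G_def T_def c_def
    by (intro has_bochner_integral_add has_bochner_integral_sum has_bochner_integral_mult_right
        has_bochner_integral_trig_product)
      (auto simp: has_bochner_integral_iff P.prob_space)
  have G_le: "(\<integral>\<^sup>+ p. ennreal (G n p) \<partial>(M \<Otimes>\<^sub>M M)) \<le> ennreal (B + 1 + ln 2)" for n
  proof -
    have "(\<integral>\<^sup>+ p. ennreal (G n p) \<partial>(M \<Otimes>\<^sub>M M)) =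
        ennreal ((\<Sum>k<m n. \<rho> n ^ k / real k * (cmod (c k))\<^sup>2) + 1 + ln 2)"
      using G_int[of n] G_nonneg
      by (subst nn_integral_eq_integral) (auto simp: has_bochner_integral_iff)
    also have "(\<Sum>k<m n. \<rho> n ^ k / real k * (cmod (c k))\<^sup>2) \<le> (\<Sum>k<m n. (cmod (c k))\<^sup>2 / real k)"
    proof (rule sum_mono)
      fix k
      have "\<rho> n ^ k * ((cmod (c k))\<^sup>2 / real k) \<le> 1 * ((cmod (c k))\<^sup>2 / real k)"
        using \<rho>[of n] by (intro mult_right_mono power_le_one) auto
      then show "\<rho> n ^ k / real k * (cmod (c k))\<^sup>2 \<le> (cmod (c k))\<^sup>2 / real k" by simp
    qed
    also have "\<dots> \<le> B" unfolding c_def by (rule B)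
    finally show ?thesis by (simp add: ennreal_leI)
  qed
  interpret \<mu>: prob_space \<mu>
    unfolding \<mu>_def by (rule prob_space_distr) simp
  have "(\<integral>\<^sup>+ p. log_kernel_pos (fst p) (snd p) \<partial>(\<mu> \<Otimes>\<^sub>M \<mu>)) =
      (\<integral>\<^sup>+ p. log_kernel_pos (cis (fst p)) (cis (snd p)) \<partial>(M \<Otimes>\<^sub>M M))"
  proof -
    have "\<mu> \<Otimes>\<^sub>M \<mu> = distr (M \<Otimes>\<^sub>M M) (borel \<Otimes>\<^sub>M borel) (\<lambda>(x, y). (cis x, cis y))"
      unfolding \<mu>_def
      by (rule pair_measure_distr) (use \<mu>.sigma_finite_measure_axioms in \<open>auto simp: \<mu>_def\<close>)
    moreover have "(\<lambda>p. log_kernel_pos (fst p) (snd p)) \<in> borel_measurable (borel \<Otimes>\<^sub>M borel)"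
      unfolding log_kernel_pos_def by measurable
    ultimately show ?thesis
      by (simp add: nn_integral_distr case_prod_unfold)
  qed
  also have "\<dots> \<le> (\<integral>\<^sup>+ p. liminf (\<lambda>n. ennreal (G n p)) \<partial>(M \<Otimes>\<^sub>M M))"
  proof (rule nn_integral_mono)
    fix p :: "real \<times> real"
    have "log_kernel_pos (cis (fst p)) (cis (snd p)) \<le>
        liminf (\<lambda>n. ennreal (dilated_kernel (\<rho> n) (cis (fst p)) (cis (snd p)) + ln 2))"
      using \<rho> \<rho>_lim by (intro log_kernel_pos_le_liminf) auto
    also have "\<dots> \<le> liminf (\<lambda>n. ennreal (G n p))"
      using G_ge[of _ "fst p" "snd p"] by (intro Liminf_mono always_eventually allI ennreal_leI) simp
    finally show "log_kernel_pos (cis (fst p)) (cis (snd p)) \<le> liminf (\<lambda>n. ennreal (G n p))" .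
  qed
  also have "\<dots> \<le> liminf (\<lambda>n. \<integral>\<^sup>+ p. ennreal (G n p) \<partial>(M \<Otimes>\<^sub>M M))"
    using G_int by (intro nn_integral_liminf) (auto dest: borel_measurable_has_bochner_integral)
  also have "\<dots> \<le> ennreal (B + 1 + ln 2)"
    using G_le by (intro Liminf_le always_eventually allI) auto
  also have "\<dots> < \<infinity>" by simp
  finally show ?thesis .
qed

text \<open>Taking arguments moves the counting measures into one bounded interval of the line, so
  they are tight and a subsequence converges weakly. The normalised power sums are their Fourier
  coefficients and converge; for each fixed \<open>m\<close> the bound on the first \<open>m\<close>
  terms survives the limit, with \<open>r n ^ k\<close> tending to 1.\<close>

lemma weak_limit_finite_energy:
  fixes x :: "nat \<Rightarrow> nat \<Rightarrow> complex" and r :: "nat \<Rightarrow> real" and N :: "nat \<Rightarrow> nat"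
  assumes E: "compact E" "E \<noteq> {}" "E \<subseteq> sphere 0 1"
    and r: "r \<longlonglongrightarrow> 1" and N: "\<And>n. 0 < N n" and x: "\<And>n i. x n i \<in> E"
    and B: "\<And>n m. (\<Sum>k<m. r n ^ k / real k * (cmod ((\<Sum>i<N n. x n i ^ k) / of_nat (N n)))\<^sup>2) \<le> B"
  obtains \<mu> where "\<mu> \<in> prob_measures_on E"
    and "(\<integral>\<^sup>+ p. log_kernel_pos (fst p) (snd p) \<partial>(\<mu> \<Otimes>\<^sub>M \<mu>)) < \<infinity>"
proof -
  define \<nu> where "\<nu> n = distr (measure_pmf (pmf_of_set {..<N n})) borel (\<lambda>i. Arg (x n i))" for n
  have real_dist: "real_distribution (\<nu> n)" for n
    unfolding \<nu>_def real_distribution_def real_distribution_axioms_def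
    by (auto intro!: measure_pmf.prob_space_distr)
  have set_pmf: "set_pmf (pmf_of_set {..<N n}) = {..<N n}" for n
    using N[of n] by (intro set_pmf_of_set) auto
  have integral: "(LINT t|\<nu> n. f t) = (\<Sum>i<N n. f (Arg (x n i))) /\<^sub>R real (N n)"
    if "f \<in> borel_measurable borel" for n and f :: "real \<Rightarrow> complex"
  proof -
    have "(LINT t|\<nu> n. f t) = (LINT i|measure_pmf (pmf_of_set {..<N n}). f (Arg (x n i)))"
      unfolding \<nu>_def using that by (intro integral_distr) auto
    also have "\<dots> = (\<Sum>i<N n. pmf (pmf_of_set {..<N n}) i *\<^sub>R f (Arg (x n i)))"
      by (rule integral_measure_pmf) (auto simp: set_pmf)
    also have "\<dots> = (\<Sum>i<N n. inverse (real (N n)) *\<^sub>R f (Arg (x n i)))"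
    proof (rule sum.cong[OF refl])
      fix i assume "i \<in> {..<N n}"
      then have "pmf (pmf_of_set {..<N n}) i = inverse (real (N n))"
        by (subst pmf_of_set) (auto simp: divide_inverse)
      then show "pmf (pmf_of_set {..<N n}) i *\<^sub>R f (Arg (x n i)) = inverse (real (N n)) *\<^sub>R f (Arg (x n i))"
        by simp
    qed
    finally show ?thesis by (simp only: scaleR_sum_right)
  qed
  have cis_Arg: "cis (Arg (x n i)) = x n i" for n i
  proof -
    have "cmod (x n i) = 1" using x[of n i] E(3) by auto
    then show ?thesis using rcis_cmod_Arg[of "x n i"] by (simp add: rcis_def)
  qed
  have "tight \<nu>"
    unfolding tight_def
  proof (intro conjI allI impI real_dist)
    fix \<epsilon> :: real assume "0 < \<epsilon>"
    have "Sigma_Algebra.measure (\<nu> n) {-4<..4} = 1" for n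
    proof -
      have "- 4 < Arg z" "Arg z \<le> 4" for z
        using Arg_bounded[of z] pi_less_4 by auto
      then have "(\<lambda>i. Arg (x n i)) -` {-4<..4} = UNIV" by auto
      then show ?thesis
        unfolding \<nu>_def by (subst measure_distr) auto
    qed
    then show "\<exists>a b. a < b \<and> (\<forall>n. 1 - \<epsilon> < Sigma_Algebra.measure (\<nu> n) {a<..b})"
      using \<open>0 < \<epsilon>\<close> by (intro exI[of _ "-4"] exI[of _ 4]) simp
  qed
  from tight_imp_convergent_subsubsequence[OF this strict_mono_id]
  obtain s M where s: "strict_mono s" and M: "real_distribution M" and "weak_conv_m (\<nu> \<circ> id \<circ> s) M"
    by blast
  then have conv: "weak_conv_m (\<lambda>n. \<nu> (s n)) M" by (simp add: o_def)
  have lim: "(\<lambda>n. (\<Sum>i<N (s n). f (Arg (x (s n) i))) /\<^sub>R real (N (s n))) \<longlonglongrightarrow> (LINT t|M. f t)"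
    if f: "continuous_on UNIV f" "\<And>t. norm (f t) \<le> C" for f :: "real \<Rightarrow> complex" and C
  proof -
    have "f \<in> borel_measurable borel"
      using f(1) by (rule borel_measurable_continuous_onI)
    moreover have "\<And>t. isCont f t"
      using f(1) by (simp add: continuous_on_eq_continuous_at)
    note weak_conv_imp_integral_bdd_continuous_conv[OF real_dist M conv this f(2)]
    ultimately show ?thesis by (simp add: integral)
  qed
  interpret M: real_distribution M by fact
  define c where "c k = (LINT t|M. cis (real k * t))" for k :: nat
  have c_lim: "(\<lambda>n. (\<Sum>i<N (s n). x (s n) i ^ k) / of_nat (N (s n))) \<longlonglongrightarrow> c k" for k
  proof -
    have "continuous_on UNIV (\<lambda>t. cis (real k * t))"
      by (intro continuous_intros)
    from lim[OF this, of 1] show ?thesis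
      by (simp add: c_def cis_Arg scaleR_conv_of_real divide_inverse mult.commute flip: Complex.DeMoivre)
  qed
  have c_le: "(\<Sum>k<m. (cmod (c k))\<^sup>2 / real k) \<le> B" for m
  proof (rule LIMSEQ_le_const2)
    have "(\<lambda>n. \<Sum>k<m. r (s n) ^ k / real k * (cmod ((\<Sum>i<N (s n). x (s n) i ^ k) / of_nat (N (s n))))\<^sup>2)
        \<longlonglongrightarrow> (\<Sum>k<m. 1 ^ k / real k * (cmod (c k))\<^sup>2)"
    proof (intro tendsto_sum tendsto_mult tendsto_power tendsto_norm c_lim)
      fix k
      have "(\<lambda>n. r (s n) ^ k * inverse (real k)) \<longlonglongrightarrow> 1 ^ k * inverse (real k)"
        using LIMSEQ_subseq_LIMSEQ[OF r s] by (intro tendsto_mult tendsto_power tendsto_const) (simp add: o_def)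
      then show "(\<lambda>n. r (s n) ^ k / real k) \<longlonglongrightarrow> 1 ^ k / real k"
        by (simp only: divide_inverse)
    qed
    then show "(\<lambda>n. \<Sum>k<m. r (s n) ^ k / real k * (cmod ((\<Sum>i<N (s n). x (s n) i ^ k) / of_nat (N (s n))))\<^sup>2)
        \<longlonglongrightarrow> (\<Sum>k<m. (cmod (c k))\<^sup>2 / real k)"
      by simp
    show "\<exists>n0. \<forall>n\<ge>n0. (\<Sum>k<m. r (s n) ^ k / real k * (cmod ((\<Sum>i<N (s n). x (s n) i ^ k) / of_nat (N (s n))))\<^sup>2) \<le> B"
      using B by blast
  qed
  have supp: "AE t in M. cis t \<in> E"
  proof -
    \<comment> \<open>The distance to \<open>E\<close> is bounded, continuous in the angle and zero
      at all the points \<open>x n i\<close>, so its integral against the weak limit is 0.\<close>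
    define f where "f t = infdist (cis t) E" for t
    have f_cont: "continuous_on UNIV f"
      unfolding f_def by (intro continuous_intros)
    obtain e where e: "e \<in> E" using E(2) by blast
    have f_nonneg: "0 \<le> f t" for t by (simp add: f_def infdist_nonneg)
    have f_bound: "\<bar>f t\<bar> \<le> 2" for t
    proof -
      have "f t \<le> dist (cis t) e" unfolding f_def by (rule infdist_le[OF e])
      also have "\<dots> \<le> cmod (cis t) + cmod e" unfolding dist_norm by (rule norm_triangle_ineq4)
      also have "\<dots> = 2" using e E(3) by auto
      finally show ?thesis by (simp add: f_def infdist_nonneg)
    qed
    have [measurable]: "f \<in> borel_measurable borel"
      using f_cont by (rule borel_measurable_continuous_onI)
    have int: "integrable M f"
      by (rule M.integrable_const_bound[where B = 2]) (use f_bound in auto)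
    have "f (Arg (x n i)) = 0" for n i
      by (simp add: f_def cis_Arg x)
    then have "(\<lambda>n. 0) \<longlonglongrightarrow> (LINT t|M. complex_of_real (f t))"
      using lim[OF continuous_on_of_real[OF f_cont], of 2] f_bound by simp
    then have "(LINT t|M. complex_of_real (f t)) = 0"
      using LIMSEQ_unique tendsto_const by blast
    then have "(LINT t|M. f t) = 0" by simp
    then have "AE t in M. f t = 0"
      using integral_nonneg_eq_0_iff_AE[OF int] f_nonneg by simp
    then show ?thesis
    proof eventually_elim
      case (elim t)
      then show ?case
        using in_closed_iff_infdist_zero[OF compact_imp_closed[OF E(1)] E(2)] by (simp add: f_def)
    qed
  qed
  show thesis
  proof
    have [measurable]: "E \<in> sets borel" using E(1) by (simp add: compact_imp_closed)
    have "AE z in distr M borel cis. z \<in> E"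
      using supp by (subst AE_distr_iff) auto
    then have "emeasure (distr M borel cis) (space (distr M borel cis) - E) = 0"
      by (subst (asm) AE_iff_measurable[OF _ refl]) (auto simp: set_diff_eq)
    then show "distr M borel cis \<in> prob_measures_on E"
      unfolding prob_measures_on_def by (auto intro!: M.prob_space_distr)
    show "(\<integral>\<^sup>+ p. log_kernel_pos (fst p) (snd p) \<partial>(distr M borel cis \<Otimes>\<^sub>M distr M borel cis)) < \<infinity>"
      using c_le unfolding c_def by (rule M.log_energy_distr_cis_finite)
  qed
qed

section \<open>Potentials of small Dirichlet norm\<close>

text \<open>If all \<open>V m\<close> stayed below \<open>B\<close>, the energies would be at most
  \<open>B + 1\<close> as \<open>r m\<close> tends to 1, and a weak limit of the counting measures
  would contradict capacity 0.\<close>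

lemma fekete_energy_unbounded:
  assumes E: "compact E" "E \<noteq> {}" "E \<subseteq> sphere 0 1" and cap: "log_capacity E = 0" and B: "0 \<le> B"
  obtains r :: real and n :: nat and x :: "nat \<Rightarrow> complex" and V I :: real
  where "0 < r" "r < 1" "2 \<le> n" "B \<le> V" "\<And>i. x i \<in> E"
    and "\<And>z. z \<in> E \<Longrightarrow> real n * V \<le> (\<Sum>j<n. dilated_kernel r z (x j))"
    and "(\<lambda>k. r ^ k / real k * (cmod ((\<Sum>i<n. x i ^ k) / of_nat n))\<^sup>2) sums I" "I \<le> V + 1"
proof -
  \<comment> \<open>The parameters are coupled: with \<open>1 - r m = 1 / n m\<close>, the diagonal
    contributes \<open>ln (n m) / n m \<le> 1\<close> to the mean energy, which is the 1 in
    \<open>I \<le> V + 1\<close>.\<close>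
  define r where "r m = 1 - inverse (real (m + 2))" for m
  define n where "n m = m + 2" for m :: nat
  have r: "0 < r m" "r m < 1" for m
    by (auto simp: r_def field_simps)
  have "\<exists>x V. (\<forall>i. x i \<in> E) \<and> (\<forall>z\<in>E. real (n m) * V \<le> (\<Sum>j<n m. dilated_kernel (r m) z (x j))) \<and>
      (\<Sum>i<n m. \<Sum>j<n m. dilated_kernel (r m) (x i) (x j)) =
      real (n m) * (real (n m) - 1) * V - real (n m) * ln (1 - r m)" for m
  proof -
    have "0 \<le> r m" "2 \<le> n m" using r(1)[of m] by (auto simp: n_def)
    from fekete_points[OF E this(1) r(2) this(2)] show ?thesis by metis
  qed
  then obtain x V where x: "\<And>m i. x m i \<in> E"
    and V: "\<And>m z. z \<in> E \<Longrightarrow> real (n m) * V m \<le> (\<Sum>j<n m. dilated_kernel (r m) z (x m j))"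
    and energy: "\<And>m. (\<Sum>i<n m. \<Sum>j<n m. dilated_kernel (r m) (x m i) (x m j)) =
      real (n m) * (real (n m) - 1) * V m - real (n m) * ln (1 - r m)"
    by metis
  define I where "I m = (real (n m) - 1) / real (n m) * V m - ln (1 - r m) / real (n m)" for m
  have sums: "(\<lambda>k. r m ^ k / real k * (cmod ((\<Sum>i<n m. x m i ^ k) / of_nat (n m)))\<^sup>2) sums I m" for m
  proof -
    have "(\<lambda>k. r m ^ k / real k * (cmod (\<Sum>i<n m. x m i ^ k))\<^sup>2 / (real (n m))\<^sup>2) sums
       ((real (n m) * (real (n m) - 1) * V m - real (n m) * ln (1 - r m)) / (real (n m))\<^sup>2)"
      unfolding energy[symmetric]
    proof (intro sums_divide dilated_energy_sums)
      show "cmod (x m i) = 1" for i using x[of m i] E(3) by auto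
    qed (use r[of m] in auto)
    moreover have "(real (n m) * (real (n m) - 1) * V m - real (n m) * ln (1 - r m)) / (real (n m))\<^sup>2 = I m"
      by (simp add: I_def n_def power2_eq_square diff_divide_distrib)
    ultimately show ?thesis
      by (simp add: norm_divide power_divide)
  qed
  have ln_le: "- (ln (1 - r m) / real (n m)) \<le> 1" for m
  proof -
    have "- ln (1 - r m) = ln (real (m + 2))"
      by (simp add: r_def ln_inverse)
    also have "\<dots> \<le> real (m + 2) - 1" by (rule ln_le_minus_one) simp
    finally have "- ln (1 - r m) / real (n m) \<le> real (n m) / real (n m)"
      by (intro divide_right_mono) (auto simp: n_def)
    then show ?thesis by (simp add: n_def)
  qed
  \<comment> \<open>The factor \<open>(n - 1) / n\<close> would increase a negative
    \<open>V m\<close>, whence the maximum with 0.\<close>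
  have I_le: "I m \<le> max 0 (V m) + 1" for m
  proof -
    have "(real (n m) - 1) / real (n m) * V m \<le> (real (n m) - 1) / real (n m) * max 0 (V m)"
      by (intro mult_left_mono) (auto simp: n_def)
    also have "\<dots> \<le> 1 * max 0 (V m)"
      by (intro mult_right_mono) (auto simp: n_def)
    finally show ?thesis using ln_le[of m] by (simp add: I_def)
  qed
  have "\<exists>m. B \<le> V m"
  proof (rule ccontr)
    assume "\<nexists>m. B \<le> V m"
    then have I_bound: "I m \<le> B + 1" for m
      using I_le[of m] B by (smt (verit))
    have r_lim: "r \<longlonglongrightarrow> 1"
    proof -
      have "(\<lambda>m. 1 - inverse (real (m + 2))) \<longlonglongrightarrow> 1 - 0"
        by (intro tendsto_intros LIMSEQ_ignore_initial_segment[OF lim_inverse_n])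
      then show ?thesis by (simp add: r_def[abs_def])
    qed
    have partial: "(\<Sum>k<j. r m ^ k / real k * (cmod ((\<Sum>i<n m. x m i ^ k) / of_nat (n m)))\<^sup>2) \<le> B + 1" for m j
    proof -
      have "(\<Sum>k<j. r m ^ k / real k * (cmod ((\<Sum>i<n m. x m i ^ k) / of_nat (n m)))\<^sup>2) \<le> I m"
        unfolding sums_unique[OF sums]
        by (rule sum_le_suminf[OF sums_summable[OF sums]]) (use r[of m] in auto)
      then show ?thesis using I_bound[of m] by linarith
    qed
    have n_pos: "0 < n m" for m by (simp add: n_def)
    obtain \<mu> where "\<mu> \<in> prob_measures_on E"
      "(\<integral>\<^sup>+ p. log_kernel_pos (fst p) (snd p) \<partial>(\<mu> \<Otimes>\<^sub>M \<mu>)) < \<infinity>"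
      by (rule weak_limit_finite_energy[OF E r_lim n_pos x partial])
    with nn_integral_log_kernel_pos_eq_infinity[OF cap] show False by simp
  qed
  then obtain m where "B \<le> V m" ..
  show thesis
  proof (rule that)
    show "0 < r m" "r m < 1" "2 \<le> n m" "B \<le> V m" "\<And>i. x m i \<in> E"
      using r x \<open>B \<le> V m\<close> by (auto simp: n_def)
    show "real (n m) * V m \<le> (\<Sum>j<n m. dilated_kernel (r m) z (x m j))" if "z \<in> E" for z
      using that by (rule V)
    show "(\<lambda>k. r m ^ k / real k * (cmod ((\<Sum>i<n m. x m i ^ k) / of_nat (n m)))\<^sup>2) sums I m"
      by (rule sums)
    show "I m \<le> V m + 1"
      using I_le[of m] B \<open>B \<le> V m\<close> by simp
  qed
qed

lemma small_potential:
  assumes E: "compact E" "E \<subseteq> sphere 0 1" and cap: "log_capacity E = 0" and \<epsilon>: "0 < \<epsilon>"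
  obtains R u where "1 < R" "u holomorphic_on ball 0 R"
    and "\<And>z. z \<in> cball 0 1 \<Longrightarrow> - 1 \<le> Re (u z)" and "\<And>z. z \<in> E \<Longrightarrow> 1 \<le> Re (u z)"
    and "dirichlet_norm u \<le> \<epsilon>"
proof (cases "E = {}")
  case True
  have "taylor_coeff (\<lambda>_. 0) k = 0" for k
    by (rule taylor_coeff_eqI[of 1]) auto
  then have "dirichlet_norm (\<lambda>_. 0) \<le> \<epsilon>"
    using \<epsilon> by (simp add: dirichlet_norm_def)
  then show thesis
    using True by (intro that[of 2 "\<lambda>_. 0"]) auto
next
  case False
  \<comment> \<open>The final bound on the squared norm is \<open>4 / V\<close>, which explains
    \<open>4 / \<epsilon>\<^sup>2\<close>. The bound \<open>V \<ge> 1\<close> gives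
    \<open>V + 1 \<le> 2 * V\<close> and, with \<open>ln 2 \<le> 1\<close>, the lower bound - 1 on
    the disc.\<close>
  have "0 \<le> max 1 (4 / \<epsilon>\<^sup>2)" by simp
  then obtain r n x V I where r: "0 < r" "r < 1" and n: "2 \<le> n" and V: "max 1 (4 / \<epsilon>\<^sup>2) \<le> V" and x: "\<And>i. x i \<in> E"
    and pot: "\<And>z. z \<in> E \<Longrightarrow> real n * V \<le> (\<Sum>j<n. dilated_kernel r z (x j))"
    and I: "(\<lambda>k. r ^ k / real k * (cmod ((\<Sum>i<n. x i ^ k) / of_nat n))\<^sup>2) sums I" "I \<le> V + 1"
    by (rule fekete_energy_unbounded[OF E(1) False E(2) cap]) (rule that)
  have V1: "1 \<le> V" "4 / \<epsilon>\<^sup>2 \<le> V" using V by auto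
  have x1: "cmod (x i) = 1" for i using x[of i] E(2) by auto
  \<comment> \<open>The real part is the mean Fekete potential divided by \<open>V\<close>. For
    \<open>|z| < 1 / r\<close> the arguments of \<open>Ln\<close> have positive real part, so the
    principal branch is holomorphic there.\<close>
  define u where "u z = (\<Sum>j<n. - Ln (1 - of_real r * z * cnj (x j))) / of_real (real n * V)" for z
  define a where "a k = (\<Sum>j<n. (of_real r * cnj (x j)) ^ k / of_nat k) / of_real (real n * V)" for k
  have inside: "cmod (of_real r * z * cnj (x j)) < 1" if "cmod z < 1 / r" for z j
    using that r x1[of j] by (simp add: norm_mult field_simps)
  have hol: "u holomorphic_on ball 0 (1 / r)"
  proof -
    have "1 - of_real r * z * cnj (x j) \<notin> \<real>\<^sub>\<le>\<^sub>0" if "cmod z < 1 / r" for z j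
    proof -
      have "Re (of_real r * z * cnj (x j)) < 1"
        using complex_Re_le_cmod[of "of_real r * z * cnj (x j)"] inside[OF that, of j] by linarith
      then show ?thesis by (auto simp: complex_nonpos_Reals_iff simp del: times_complex.sel)
    qed
    then show ?thesis
      unfolding u_def by (intro holomorphic_intros) auto
  qed
  have coeff: "taylor_coeff u k = a k" for k
  proof (rule taylor_coeff_eqI[OF _ hol])
    fix z assume z: "cmod z < 1 / r"
    have "(\<lambda>k. (\<Sum>j<n. (of_real r * z * cnj (x j)) ^ k / of_nat k) / of_real (real n * V)) sums u z"
      unfolding u_def by (intro sums_divide sums_sum neg_Ln_sums inside z)
    moreover have "(\<Sum>j<n. (of_real r * z * cnj (x j)) ^ k / of_nat k) / of_real (real n * V) = a k * z ^ k" for k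
      unfolding a_def times_divide_eq_left sum_distrib_right
      by (intro arg_cong2[of _ _ _ _ "(/)"] sum.cong refl) (simp add: power_mult_distrib)
    ultimately show "(\<lambda>k. a k * z ^ k) sums u z"
      by simp
  qed (use r in simp)
  have Re_u: "Re (u z) = (\<Sum>j<n. dilated_kernel r z (x j)) / (real n * V)" if "cmod z < 1 / r" for z
  proof -
    have "Re (u z) = (\<Sum>j<n. Re (- Ln (1 - of_real r * z * cnj (x j)))) / (real n * V)"
      by (simp only: u_def Re_divide_of_real Re_sum)
    then show ?thesis
      by (simp only: Re_neg_Ln[OF inside[OF that]] dilated_kernel_def)
  qed
  have r1: "1 < 1 / r" using r by simp
  have nV: "0 < real n * V" using n V1 by simp
  show thesis
  proof (rule that[OF r1 hol])
    fix z :: complex assume "z \<in> cball 0 1"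
    then have z: "cmod z \<le> 1" by simp
    then have z': "cmod z < 1 / r" using r1 by linarith
    have "- ln 2 \<le> dilated_kernel r z (x j)" for j
    proof -
      have "cmod (1 - of_real r * z * cnj (x j)) \<le> 2"
        using norm_triangle_ineq4[of 1 "of_real r * z * cnj (x j)"] inside[OF z', of j] by simp
      moreover have "1 - of_real r * z * cnj (x j) \<noteq> 0"
        using inside[OF z', of j] by auto
      ultimately show ?thesis by (simp add: dilated_kernel_def)
    qed
    then have "(\<Sum>j<n. - ln 2) \<le> (\<Sum>j<n. dilated_kernel r z (x j))"
      by (rule sum_mono)
    moreover have "ln 2 \<le> (1::real)" using ln_le_minus_one[of 2] by simp
    then have "real n * ln 2 \<le> real n * V" using V1 by (intro mult_left_mono) auto
    ultimately show "- 1 \<le> Re (u z)"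
      unfolding Re_u[OF z'] using nV by (simp add: le_divide_eq)
  next
    fix z assume z: "z \<in> E"
    then have "cmod z < 1 / r" using E(2) r1 by auto
    from Re_u[OF this] pot[OF z] nV show "1 \<le> Re (u z)" by (simp add: le_divide_eq)
  next
    have Iu: "(\<lambda>k. 2 / V\<^sup>2 * (r ^ k / real k * (cmod ((\<Sum>i<n. x i ^ k) / of_nat n))\<^sup>2)) sums (2 / V\<^sup>2 * I)"
      using I(1) by (rule sums_mult)
    \<comment> \<open>The factor 2 bounds \<open>(k + 1) / k\<close>, and one of the two powers
      \<open>r ^ k\<close> is bounded by 1. At \<open>k = 0\<close> both sides vanish because
      division by 0 gives 0.\<close>
    have le: "real (k + 1) * (cmod (taylor_coeff u k))\<^sup>2 \<le>
        2 / V\<^sup>2 * (r ^ k / real k * (cmod ((\<Sum>i<n. x i ^ k) / of_nat n))\<^sup>2)" for k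
    proof (cases "k = 0")
      case True
      then show ?thesis by (simp add: coeff a_def)
    next
      case False
      define S where "S = cmod ((\<Sum>i<n. x i ^ k) / of_nat n)"
      have "a k = of_real (r ^ k / real k / V) * cnj ((\<Sum>i<n. x i ^ k) / of_nat n)"
        by (simp add: a_def power_mult_distrib sum_divide_distrib sum_distrib_left mult_ac)
      then have "cmod (a k) = r ^ k / real k / V * S"
        using r V1 by (simp only: S_def norm_mult complex_mod_cnj norm_of_real) simp
      then have "real (k + 1) * (cmod (taylor_coeff u k))\<^sup>2 =
          ((real (k + 1) / real k) * (r ^ k * r ^ k)) * (1 / real k * (1 / V\<^sup>2) * S\<^sup>2)"
        by (simp add: coeff power2_eq_square mult_ac)
      also have "\<dots> \<le> (2 * (r ^ k * 1)) * (1 / real k * (1 / V\<^sup>2) * S\<^sup>2)"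
        using False r by (intro mult_right_mono mult_mono power_le_one) (auto simp: field_simps)
      finally show ?thesis by (simp add: S_def mult_ac)
    qed
    have Du: "u \<in> dirichlet_space"
      using hol r1 by (rule holomorphic_imp_dirichlet_space)
    have "(dirichlet_norm u)\<^sup>2 \<le> 2 / V\<^sup>2 * I"
      unfolding dirichlet_norm_power2[OF Du] sums_unique[OF Iu]
      using Du by (intro suminf_le le sums_summable[OF Iu]) (simp add: dirichlet_space_def)
    also have "\<dots> \<le> 2 / V\<^sup>2 * (2 * V)"
      using I(2) V1 by (intro mult_left_mono) auto
    also have "\<dots> = 4 / V" using V1 by (simp add: power2_eq_square)
    also have "\<dots> \<le> \<epsilon>\<^sup>2" using V1 \<epsilon> by (simp add: field_simps)
    finally show "dirichlet_norm u \<le> \<epsilon>"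
      by (rule power2_le_imp_le) (use \<epsilon> in simp)
  qed
qed

section \<open>Perturbing by cutoff functions\<close>

text \<open>The mean value inequality on the convex half-plane \<open>Re z \<le> B\<close>, where
  \<open>|exp z| \<le> exp B\<close>.\<close>

lemma norm_exp_diff_le:
  fixes x y :: complex
  assumes "Re x \<le> B" "Re y \<le> B"
  shows "cmod (exp x - exp y) \<le> exp B * cmod (x - y)"
proof (rule field_differentiable_bound[where S = "{z. Re z \<le> B}" and f = exp and f' = exp])
  show "convex {z. Re z \<le> B}" by (rule convex_halfspace_Re_le)
qed (use assms in \<open>auto intro!: DERIV_subset[OF DERIV_exp]\<close>)

text \<open>\<open>C\<close> is fixed before \<open>u\<close> and \<open>R'\<close>, so it cannot
  depend on the size of \<open>u\<close>. The one-sided bound on \<open>Re u\<close> is enough: it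
  bounds the cutoff and makes it Lipschitz in \<open>u\<close>, so the difference is dominated by
  \<open>|u|\<close> and its derivative by \<open>|u| + |deriv u|\<close>.\<close>

lemma exp_of_cutoff_perturbation:
  assumes G: "G holomorphic_on ball 0 R" and p: "p holomorphic_on ball 0 R" and R: "1 < R" and M: "0 \<le> M"
  obtains C :: real where "0 \<le> C"
    and "\<And>R' u. \<lbrakk>1 < R'; R' \<le> R; u holomorphic_on ball 0 R'; \<And>z. z \<in> cball 0 1 \<Longrightarrow> - 1 \<le> Re (u z)\<rbrakk> \<Longrightarrow>
      dirichlet_norm (\<lambda>z. exp (G z + (1 - exp (- of_real M * u z)) * p z) - exp (G z)) \<le> C * dirichlet_norm u"
proof -
  have bound: "\<exists>B. \<forall>z\<in>cball 0 1. cmod (h z) \<le> B" if "h holomorphic_on ball 0 R" for h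
  proof -
    have "cball 0 1 \<subseteq> ball (0::complex) R" using R by auto
    then have "continuous_on (cball 0 1) h"
      using that holomorphic_on_imp_continuous_on continuous_on_subset by blast
    then have "bounded (h ` cball 0 1)"
      by (intro compact_imp_bounded compact_continuous_image) auto
    then show ?thesis by (auto simp: bounded_iff)
  qed
  obtain B1 B2 B3 B4 where B: "\<forall>z\<in>cball 0 1. cmod (deriv G z) \<le> B1" "\<forall>z\<in>cball 0 1. cmod (exp (G z)) \<le> B2"
      "\<forall>z\<in>cball 0 1. cmod (p z) \<le> B3" "\<forall>z\<in>cball 0 1. cmod (deriv p z) \<le> B4"
    using bound[OF holomorphic_deriv[OF G]] bound[OF holomorphic_on_compose[OF G holomorphic_on_exp]] bound[OF p] bound[OF holomorphic_deriv[OF p]]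
    by (auto simp: o_def)
  define A where "A = Max {1, B1, B2, B3, B4}"
  have A: "1 \<le> A" "\<And>z. cmod z \<le> 1 \<Longrightarrow> cmod (deriv G z) \<le> A" "\<And>z. cmod z \<le> 1 \<Longrightarrow> cmod (exp (G z)) \<le> A"
      "\<And>z. cmod z \<le> 1 \<Longrightarrow> cmod (p z) \<le> A" "\<And>z. cmod z \<le> 1 \<Longrightarrow> cmod (deriv p z) \<le> A"
  proof -
    have "B1 \<le> A" "B2 \<le> A" "B3 \<le> A" "B4 \<le> A" "1 \<le> A" by (auto simp: A_def)
    then show "1 \<le> A" "\<And>z. cmod z \<le> 1 \<Longrightarrow> cmod (deriv G z) \<le> A" "\<And>z. cmod z \<le> 1 \<Longrightarrow> cmod (exp (G z)) \<le> A"
      "\<And>z. cmod z \<le> 1 \<Longrightarrow> cmod (p z) \<le> A" "\<And>z. cmod z \<le> 1 \<Longrightarrow> cmod (deriv p z) \<le> A"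
      using B by (meson mem_cball_0 order_trans)+
  qed
  \<comment> \<open>\<open>b\<close> bounds \<open>|h|\<close>, as
    \<open>|\<psi>| \<le> 1 + exp M\<close> and \<open>|p| \<le> A\<close>. In \<open>D\<close>, the
    factors \<open>A\<close> and \<open>exp b\<close> bound \<open>exp G\<close> and
    \<open>exp h\<close>, and \<open>A * exp M * M\<close> is the constant in the bounds of
    \<open>h\<close> and its derivative by \<open>u\<close> and \<open>deriv u\<close>.\<close>
  define b where "b = A * (1 + exp M)"
  define D where "D = A * exp b * (A * exp M * M)"
  have D: "0 \<le> D" using A(1) M by (simp add: D_def)
  show thesis
  proof (rule that)
    show "0 \<le> 3 * ((A + 1) * D)" using A(1) D by simp
    fix R' u assume R': "1 < R'" "R' \<le> R" and u: "u holomorphic_on ball 0 R'"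
      and Re_u: "\<And>z. z \<in> cball 0 1 \<Longrightarrow> - 1 \<le> Re (u z)"
    have sub: "ball 0 R' \<subseteq> ball (0::complex) R" using R' by auto
    note G' = holomorphic_on_subset[OF G sub] and p' = holomorphic_on_subset[OF p sub]
    define \<psi> where "\<psi> z = 1 - exp (- of_real M * u z)" for z
    define h where "h z = \<psi> z * p z" for z
    define v where "v z = exp (G z + h z) - exp (G z)" for z
    have hol: "v holomorphic_on ball 0 R'"
      unfolding v_def h_def \<psi>_def by (intro holomorphic_intros G' p' u)
    have est: "cmod (v z) \<le> D * cmod (u z)"
      "cmod (deriv v z) \<le> A * cmod (v z) + D * (cmod (u z) + cmod (deriv u z))" if "z \<in> cball 0 1" for z
    proof -
      have z: "cmod z \<le> 1" and zR: "z \<in> ball 0 R'" using that R' by auto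
      have "M * - 1 \<le> M * Re (u z)" using M Re_u[OF that] by (rule mult_left_mono[rotated])
      then have ReM: "Re (- of_real M * u z) \<le> M" by simp
      have eM: "cmod (exp (- of_real M * u z)) \<le> exp M"
        using ReM by (simp only: norm_exp_eq_Re exp_le_cancel_iff)
      \<comment> \<open>This bound, linear in \<open>u\<close>, makes \<open>v\<close> small; the
        constant bound \<open>1 + exp M\<close> that follows keeps \<open>exp (h z)\<close> under
        control.\<close>
      have psi: "cmod (\<psi> z) \<le> exp M * M * cmod (u z)"
        using norm_exp_diff_le[of 0 M "- of_real M * u z"] ReM M
        by (simp add: \<psi>_def norm_mult)
      have "cmod (\<psi> z) \<le> 1 + exp M"
        using norm_triangle_ineq4[of 1 "exp (- of_real M * u z)"] eM
        unfolding \<psi>_def norm_one by linarith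
      then have "cmod (h z) \<le> (1 + exp M) * A"
        unfolding h_def norm_mult using A(4)[OF z] by (intro mult_mono) auto
      then have hb: "cmod (h z) \<le> b" by (simp add: b_def mult.commute)
      then have b0: "0 \<le> b" using norm_ge_zero order_trans by blast
      have Reh: "Re (h z) \<le> b" using hb complex_Re_le_cmod order_trans by blast
      have hu: "cmod (h z) \<le> A * exp M * M * cmod (u z)"
      proof -
        have "cmod (h z) \<le> exp M * M * cmod (u z) * A"
          unfolding h_def norm_mult using psi A(4)[OF z] by (intro mult_mono) (auto simp: M)
        then show ?thesis by (simp add: mult_ac)
      qed
      have "v z = exp (G z) * (exp (h z) - exp 0)"
        by (simp add: v_def exp_add algebra_simps)
      then have "cmod (v z) \<le> A * (exp b * cmod (h z))"
        unfolding norm_mult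
        using A(3)[OF z] norm_exp_diff_le[OF Reh, of 0] b0 A(1) by (auto simp: norm_mult intro!: mult_mono)
      also have "\<dots> \<le> A * (exp b * (A * exp M * M * cmod (u z)))"
        using hu A(1) by (intro mult_left_mono) auto
      finally show "cmod (v z) \<le> D * cmod (u z)" by (simp add: D_def mult_ac)
      define h' where "h' = of_real M * deriv u z * exp (- of_real M * u z) * p z + \<psi> z * deriv p z"
      have "(v has_field_derivative (deriv G z + h') * exp (G z + h z) - deriv G z * exp (G z)) (at z)"
      proof -
        note du = holomorphic_derivI[OF u open_ball zR] and dG = holomorphic_derivI[OF G' open_ball zR]
          and dp = holomorphic_derivI[OF p' open_ball zR]
        show ?thesis
          unfolding v_def[abs_def] h_def \<psi>_def h'_def
          by (rule derivative_eq_intros du dG dp refl | simp)+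
      qed
      then have "deriv v z = (deriv G z + h') * exp (G z + h z) - deriv G z * exp (G z)"
        by (rule DERIV_imp_deriv)
      \<comment> \<open>Regrouped so that every term carries a small factor: the two terms with
        \<open>deriv G\<close> combine to a multiple of \<open>v\<close>, and \<open>h'\<close> is
        controlled by \<open>u\<close> and \<open>deriv u\<close>.\<close>
      also have "\<dots> = deriv G z * v z + exp (G z) * exp (h z) * h'"
        by (simp add: v_def exp_add algebra_simps)
      finally have "cmod (deriv v z) \<le> cmod (deriv G z * v z) + cmod (exp (G z) * exp (h z) * h')"
        using norm_triangle_ineq by metis
      also have "cmod (deriv G z * v z) \<le> A * cmod (v z)"
        unfolding norm_mult using A(2)[OF z] by (rule mult_right_mono) simp
      also have "cmod (exp (G z) * exp (h z) * h') \<le> A * exp b * (A * exp M * M * (cmod (u z) + cmod (deriv u z)))"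
      proof -
        have "cmod (exp (h z)) \<le> exp b" using Reh by simp
        moreover have "cmod h' \<le> A * exp M * M * (cmod (u z) + cmod (deriv u z))"
        proof -
          have "cmod (of_real M * deriv u z * exp (- of_real M * u z) * p z) \<le> M * cmod (deriv u z) * exp M * A"
            unfolding norm_mult using eM A(4)[OF z] M by (intro mult_mono) (auto simp: norm_mult)
          moreover have "cmod (\<psi> z * deriv p z) \<le> exp M * M * cmod (u z) * A"
            unfolding norm_mult using psi A(5)[OF z] M by (intro mult_mono) auto
          ultimately have "cmod h' \<le> M * cmod (deriv u z) * exp M * A + exp M * M * cmod (u z) * A"
            unfolding h'_def using norm_triangle_mono by blast
          then show ?thesis by (simp add: algebra_simps)
        qed
        ultimately show ?thesis
          unfolding norm_mult using A(1) A(3)[OF z] by (intro mult_mono) auto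
      qed
      finally show "cmod (deriv v z) \<le> A * cmod (v z) + D * (cmod (u z) + cmod (deriv u z))"
        by (simp add: D_def mult_ac)
    qed
    have "dirichlet_norm v \<le> 3 * ((A + 1) * D) * dirichlet_norm u"
    proof (rule dirichlet_norm_dominated[OF u hol R'(1)])
      show "0 \<le> (A + 1) * D" using A(1) D by simp
      fix z :: complex assume z: "z \<in> cball 0 1"
      have "D * cmod (u z) \<le> (A + 1) * D * cmod (u z)"
        using A(1) D by (intro mult_right_mono) (auto simp: mult_le_cancel_right1 algebra_simps)
      with est(1)[OF z] show "cmod (v z) \<le> (A + 1) * D * cmod (u z)" by linarith
      have "A * cmod (v z) \<le> A * (D * (cmod (u z) + cmod (deriv u z)))"
        using A(1) est(1)[OF z] D by (intro mult_left_mono order_trans[OF est(1)[OF z]]) (auto intro: mult_left_mono)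
      with est(2)[OF z] show "cmod (deriv v z) \<le> (A + 1) * D * (cmod (u z) + cmod (deriv u z))"
        by (simp add: algebra_simps)
    qed
    then show "dirichlet_norm (\<lambda>z. exp (G z + (1 - exp (- of_real M * u z)) * p z) - exp (G z)) \<le>
        3 * ((A + 1) * D) * dirichlet_norm u"
      by (simp add: v_def[abs_def] h_def \<psi>_def)
  qed
qed

section \<open>Uniform approximation on the exceptional set\<close>

text \<open>Membership in the uniform closure on \<open>E\<close> of the functions holomorphic
  across the closed disc; the radius \<open>R\<close> may shrink to 1 as the accuracy
  improves.\<close>

definition disc_approximable :: "complex set \<Rightarrow> (complex \<Rightarrow> complex) \<Rightarrow> bool" where
  "disc_approximable E f \<longleftrightarrow> (\<forall>\<epsilon>>0. \<exists>R>1. \<exists>p. p holomorphic_on ball 0 R \<and> (\<forall>z\<in>E. cmod (p z - f z) \<le> \<epsilon>))"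

lemma disc_approximable_holomorphic:
  assumes "f holomorphic_on ball 0 R" "1 < R"
  shows "disc_approximable E f"
  unfolding disc_approximable_def using assms by (intro allI impI exI[of _ R] conjI exI[of _ f]) auto

lemma disc_approximable_add:
  assumes "disc_approximable E f" "disc_approximable E g"
  shows "disc_approximable E (\<lambda>z. f z + g z)"
  unfolding disc_approximable_def
proof (intro allI impI)
  fix \<epsilon> :: real assume "0 < \<epsilon>"
  then have "0 < \<epsilon> / 2" by simp
  with assms obtain R p S q where p: "1 < R" "p holomorphic_on ball 0 R" "\<And>z. z \<in> E \<Longrightarrow> cmod (p z - f z) \<le> \<epsilon> / 2"
    and q: "1 < S" "q holomorphic_on ball 0 S" "\<And>z. z \<in> E \<Longrightarrow> cmod (q z - g z) \<le> \<epsilon> / 2"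
    unfolding disc_approximable_def by meson
  have "(\<lambda>z. p z + q z) holomorphic_on ball 0 (min R S)"
    by (intro holomorphic_intros holomorphic_on_subset[OF p(2)] holomorphic_on_subset[OF q(2)]) auto
  moreover have "cmod (p z + q z - (f z + g z)) \<le> \<epsilon>" if "z \<in> E" for z
    using norm_triangle_ineq[of "p z - f z" "q z - g z"] p(3)[OF that] q(3)[OF that]
    by (simp add: algebra_simps)
  ultimately show "\<exists>R>1. \<exists>p. p holomorphic_on ball 0 R \<and> (\<forall>z\<in>E. cmod (p z - (f z + g z)) \<le> \<epsilon>)"
    using p(1) q(1) by (intro exI[of _ "min R S"]) auto
qed

lemma disc_approximable_bounded:
  assumes "disc_approximable E f" "compact E" "E \<subseteq> cball 0 1"
  obtains B where "0 \<le> B" "\<And>z. z \<in> E \<Longrightarrow> cmod (f z) \<le> B"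
proof -
  obtain R p where p: "1 < R" "p holomorphic_on ball 0 R" "\<And>z. z \<in> E \<Longrightarrow> cmod (p z - f z) \<le> 1"
    using assms(1) unfolding disc_approximable_def by (meson zero_less_one)
  have "E \<subseteq> ball 0 R" using assms(3) p(1) by auto
  then have "continuous_on E p"
    using p(2) holomorphic_on_imp_continuous_on continuous_on_subset by blast
  then have "bounded (p ` E)"
    using assms(2) by (intro compact_imp_bounded compact_continuous_image)
  then obtain B where B: "\<And>z. z \<in> E \<Longrightarrow> cmod (p z) \<le> B"
    by (auto simp: bounded_iff)
  have "cmod (f z) \<le> \<bar>B\<bar> + 1" if "z \<in> E" for z
    using norm_triangle_ineq4[of "p z" "p z - f z"] p(3)[OF that] B[OF that] by simp
  then show thesis by (intro that[of "\<bar>B\<bar> + 1"]) auto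
qed

lemma disc_approximable_mult:
  assumes f: "disc_approximable E f" and g: "disc_approximable E g" and E: "compact E" "E \<subseteq> cball 0 1"
  shows "disc_approximable E (\<lambda>z. f z * g z)"
  unfolding disc_approximable_def
proof (intro allI impI)
  fix \<epsilon> :: real assume \<epsilon>: "0 < \<epsilon>"
  obtain A where A: "0 \<le> A" "\<And>z. z \<in> E \<Longrightarrow> cmod (f z) \<le> A"
    using disc_approximable_bounded[OF f E] by blast
  obtain B where B: "0 \<le> B" "\<And>z. z \<in> E \<Longrightarrow> cmod (g z) \<le> B"
    using disc_approximable_bounded[OF g E] by blast
  \<comment> \<open>The cap at 1 gives \<open>|q| \<le> B + 1\<close>, so the error of the product
    is at most \<open>\<delta> * (B + 1) + A * \<delta>\<close>.\<close>
  define \<delta> where "\<delta> = min 1 (\<epsilon> / (A + B + 1))"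
  have \<delta>: "0 < \<delta>" "\<delta> \<le> 1" "\<delta> * (A + B + 1) \<le> \<epsilon>"
  proof -
    show "0 < \<delta>" "\<delta> \<le> 1" using \<epsilon> A(1) B(1) by (auto simp: \<delta>_def)
    have "\<delta> \<le> \<epsilon> / (A + B + 1)" by (simp add: \<delta>_def)
    then show "\<delta> * (A + B + 1) \<le> \<epsilon>" using A(1) B(1) by (simp add: le_divide_eq)
  qed
  from f g \<delta>(1) obtain R p S q where p: "1 < R" "p holomorphic_on ball 0 R" "\<And>z. z \<in> E \<Longrightarrow> cmod (p z - f z) \<le> \<delta>"
    and q: "1 < S" "q holomorphic_on ball 0 S" "\<And>z. z \<in> E \<Longrightarrow> cmod (q z - g z) \<le> \<delta>"
    unfolding disc_approximable_def by meson
  have "(\<lambda>z. p z * q z) holomorphic_on ball 0 (min R S)"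
    by (intro holomorphic_intros holomorphic_on_subset[OF p(2)] holomorphic_on_subset[OF q(2)]) auto
  moreover have "cmod (p z * q z - f z * g z) \<le> \<epsilon>" if z: "z \<in> E" for z
  proof -
    have q': "cmod (q z) \<le> B + 1"
      using norm_triangle_ineq[of "q z - g z" "g z"] q(3)[OF z] B(2)[OF z] \<delta>(2) by simp
    have "p z * q z - f z * g z = (p z - f z) * q z + f z * (q z - g z)"
      by (simp add: algebra_simps)
    then have "cmod (p z * q z - f z * g z) \<le> cmod (p z - f z) * cmod (q z) + cmod (f z) * cmod (q z - g z)"
      using norm_triangle_ineq[of "(p z - f z) * q z" "f z * (q z - g z)"] by (simp add: norm_mult)
    also have "\<dots> \<le> \<delta> * (B + 1) + A * \<delta>"
      using p(3)[OF z] q(3)[OF z] q' A B(1) z \<delta>(1) by (intro add_mono mult_mono) auto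
    also have "\<dots> \<le> \<epsilon>" using \<delta>(3) by (simp add: algebra_simps)
    finally show ?thesis .
  qed
  ultimately show "\<exists>R>1. \<exists>p. p holomorphic_on ball 0 R \<and> (\<forall>z\<in>E. cmod (p z - f z * g z) \<le> \<epsilon>)"
    using p(1) q(1) by (intro exI[of _ "min R S"]) auto
qed

text \<open>On \<open>E\<close> the conjugate is \<open>1 / z\<close>, and \<open>(1 - exp (- M (u z - u 0))) / z\<close> has a removable singularity.\<close>

lemma disc_approximable_cnj:
  assumes E: "compact E" "E \<subseteq> sphere 0 1" and cap: "log_capacity E = 0"
  shows "disc_approximable E cnj"
  unfolding disc_approximable_def
proof (intro allI impI)
  fix \<epsilon> :: real assume \<epsilon>: "0 < \<epsilon>"
  \<comment> \<open>Norm at most 1/2 forces \<open>|u 0| \<le> 1 / 2\<close>, which leaves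
    \<open>Re (u z - u 0) \<ge> 1 / 2\<close> on \<open>E\<close>; the error there is at most
    \<open>exp (- M / 2)\<close>.\<close>
  define M where "M = max 0 (2 * ln (1 / \<epsilon>))"
  have M: "0 \<le> M" "exp (- M / 2) \<le> \<epsilon>"
  proof -
    have "- M / 2 \<le> ln \<epsilon>" using \<epsilon> by (simp add: M_def ln_div)
    then have "exp (- M / 2) \<le> exp (ln \<epsilon>)" by simp
    then show "exp (- M / 2) \<le> \<epsilon>" using \<epsilon> by simp
  qed (simp add: M_def)
  have "(0::real) < 1 / 2" by simp
  from small_potential[OF E cap this] obtain R u where u: "1 < R" "u holomorphic_on ball 0 R"
    and Re_u: "\<And>z. z \<in> E \<Longrightarrow> 1 \<le> Re (u z)" and nu: "dirichlet_norm u \<le> 1 / 2"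
    by metis
  have "cmod (u 0) \<le> 1 / 2"
    using cmod_0_le_dirichlet_norm[OF holomorphic_imp_dirichlet_space[OF u(2,1)]] nu by linarith
  then have Re0: "Re (u 0) \<le> 1 / 2" using complex_Re_le_cmod[of "u 0"] by linarith
  define w where "w z = - exp (- of_real M * (u z - u 0))" for z
  define p where "p z = (if z = 0 then deriv w 0 else (w z - w 0) / (z - 0))" for z
  have "w holomorphic_on ball 0 R"
    unfolding w_def using u(2) by (intro holomorphic_intros)
  then have "p holomorphic_on ball 0 R"
    unfolding p_def by (rule pole_lemma_open) simp
  moreover have "cmod (p z - cnj z) \<le> \<epsilon>" if z: "z \<in> E" for z
  proof -
    have z1: "cmod z = 1" using z E(2) by auto
    then have "z * cnj z = 1" by (simp flip: complex_norm_square)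
    then have "p z - cnj z = w z / z"
      using z1 by (auto simp: p_def w_def field_simps)
    then have "cmod (p z - cnj z) = exp (- (M * (Re (u z) - Re (u 0))))"
      using z1 by (simp add: norm_divide w_def)
    also have "\<dots> \<le> exp (- M / 2)"
      using mult_left_mono[OF _ M(1), of "1 / 2" "Re (u z) - Re (u 0)"] Re0 Re_u[OF z] by simp
    finally show ?thesis using M(2) by linarith
  qed
  ultimately show "\<exists>R>1. \<exists>p. p holomorphic_on ball 0 R \<and> (\<forall>z\<in>E. cmod (p z - cnj z) \<le> \<epsilon>)"
    using u(1) by blast
qed

text \<open>Approximable functions form an algebra containing the constants and \<open>z\<close>;
  capacity 0 adds \<open>cnj z\<close>, and with it all real polynomials in \<open>Re z\<close> and
  \<open>Im z\<close>. Stone-Weierstrass does the rest.\<close>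

lemma disc_approximable_continuous:
  assumes E: "compact E" "E \<subseteq> sphere 0 1" and cap: "log_capacity E = 0" and f: "continuous_on E f"
  shows "disc_approximable E f"
proof -
  have E': "E \<subseteq> cball 0 1" using E(2) by auto
  have const: "disc_approximable E (\<lambda>_. c)" for c
    by (rule disc_approximable_holomorphic[of _ 2]) auto
  have ident: "disc_approximable E (\<lambda>z. z)"
    by (rule disc_approximable_holomorphic[of _ 2]) auto
  note cnj = disc_approximable_cnj[OF E cap]
  note intros = disc_approximable_add disc_approximable_mult[OF _ _ E(1) E'] const ident cnj
  have poly: "disc_approximable E (\<lambda>z. of_real (q z))" if "real_polynomial_function q" for q :: "complex \<Rightarrow> real"
    using that
  proof induction
    case (linear q)
    then interpret bounded_linear q .
    have q: "q z = Re z * q 1 + Im z * q \<i>" for z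
    proof -
      have "q z = q (Re z *\<^sub>R 1 + Im z *\<^sub>R \<i>)"
        by (rule arg_cong[of _ _ q]) (simp add: complex_eq_iff)
      also have "\<dots> = Re z * q 1 + Im z * q \<i>"
        by (simp only: add scaleR real_scaleR_def)
      finally show ?thesis .
    qed
    define a b where "a = complex_of_real (q 1)" and "b = complex_of_real (q \<i>)"
    have "complex_of_real (q z) = (a / 2 + - \<i> * b / 2) * z + (a / 2 + \<i> * b / 2) * cnj z" for z
      by (subst q) (simp add: a_def b_def complex_eq_iff)
    then show ?case by (simp only:) (intro intros)
  next
    case (const c)
    then show ?case by (intro intros)
  next
    case (add p q)
    then show ?case by (simp only: of_real_add) (intro intros)
  next
    case (mult p q)
    then show ?case by (simp only: of_real_mult) (intro intros)
  qed
  have "\<exists>R>1. \<exists>p. p holomorphic_on ball 0 R \<and> (\<forall>z\<in>E. cmod (p z - f z) \<le> \<epsilon>)" if "0 < \<epsilon>" for \<epsilon>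
  proof -
    have \<epsilon>: "0 < \<epsilon> / 2" using that by simp
    obtain q where q: "polynomial_function q" "\<And>z. z \<in> E \<Longrightarrow> cmod (f z - q z) < \<epsilon> / 2"
      using Stone_Weierstrass_polynomial_function[OF E(1) f \<epsilon>] by blast
    have "real_polynomial_function (\<lambda>z. Re (q z))" "real_polynomial_function (\<lambda>z. Im (q z))"
      using q(1) bounded_linear_Re bounded_linear_Im by (auto simp: polynomial_function_def o_def)
    then have "disc_approximable E (\<lambda>z. of_real (Re (q z)) + \<i> * of_real (Im (q z)))"
      by (intro intros poly)
    then have "disc_approximable E q"
      by (simp only: complex_eq[symmetric])
    then obtain R p where p: "1 < R" "p holomorphic_on ball 0 R" "\<And>z. z \<in> E \<Longrightarrow> cmod (p z - q z) \<le> \<epsilon> / 2"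
      using \<epsilon> unfolding disc_approximable_def by meson
    have "cmod (p z - f z) \<le> \<epsilon>" if "z \<in> E" for z
      using norm_triangle_ineq4[of "p z - q z" "f z - q z"] p(3)[OF that] q(2)[OF that] by simp
    then show ?thesis using p(1,2) by blast
  qed
  then show ?thesis by (simp add: disc_approximable_def)
qed

section \<open>The complement of a set of capacity zero\<close>

text \<open>On the full circle, the maximum principle for \<open>exp (- u)\<close> would carry
  \<open>Re u \<ge> 1\<close> to the centre, where the small norm forces
  \<open>Re u \<le> 1 / 2\<close>.\<close>

lemma log_capacity_0_neq_circle:
  assumes E: "compact E" "E \<subseteq> sphere 0 1" and cap: "log_capacity E = 0"
  shows "E \<noteq> sphere 0 1"
proof
  assume sphere: "E = sphere 0 1"
  have "(0::real) < 1 / 2" by simp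
  from small_potential[OF E cap this] obtain R u where u: "1 < R" "u holomorphic_on ball 0 R"
    and Re_u: "\<And>z. z \<in> E \<Longrightarrow> 1 \<le> Re (u z)" and nu: "dirichlet_norm u \<le> 1 / 2"
    by metis
  have "cmod (u 0) \<le> 1 / 2"
    using cmod_0_le_dirichlet_norm[OF holomorphic_imp_dirichlet_space[OF u(2,1)]] nu by linarith
  then have Re0: "Re (u 0) \<le> 1 / 2" using complex_Re_le_cmod[of "u 0"] by linarith
  have hol: "(\<lambda>z. exp (- u z)) holomorphic_on ball 0 R"
    using u(2) by (intro holomorphic_intros)
  have sub: "cball 0 1 \<subseteq> ball (0::complex) R" using u(1) by auto
  have "cmod (exp (- u 0)) \<le> exp (- 1)"
  proof (rule maximum_modulus_frontier[of "\<lambda>z. exp (- u z)" "cball 0 1"])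
    show "(\<lambda>z. exp (- u z)) holomorphic_on interior (cball 0 1)"
      using sub by (intro holomorphic_on_subset[OF hol]) (auto dest: subsetD[OF interior_subset])
    show "continuous_on (closure (cball 0 1)) (\<lambda>z. exp (- u z))"
      using sub by (simp add: holomorphic_on_imp_continuous_on holomorphic_on_subset[OF hol])
    show "cmod (exp (- u z)) \<le> exp (- 1)" if "z \<in> frontier (cball 0 1)" for z
      using Re_u[of z] that sphere by (simp add: frontier_cball)
  qed auto
  then show False using Re0 by simp
qed

text \<open>A point of the circle outside \<open>E\<close> lies in the closure of both the disc and
  the exterior and joins the two.\<close>

lemma connected_complement_proper_subset_circle:
  fixes E :: "complex set"
  assumes "E \<subseteq> sphere 0 1" "E \<noteq> sphere 0 1"
  shows "connected (- E)"
proof -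
  define S where "S = sphere 0 1 - E"
  have S: "S \<noteq> {}" using assms by (auto simp: S_def)
  have "connected (ball 0 1 \<union> S)"
    by (rule connected_intermediate_closure[of "ball 0 1"]) (auto simp: S_def)
  moreover have "connected (- cball 0 1 \<union> S)"
  proof (rule connected_intermediate_closure[of "- cball 0 1"])
    show "connected (- cball (0::complex) 1)"
      by (rule connected_complement_bounded_convex) auto
    show "- cball 0 1 \<union> S \<subseteq> closure (- cball 0 1)"
      by (auto simp: S_def closure_complement)
  qed auto
  ultimately have "connected ((ball 0 1 \<union> S) \<union> (- cball 0 1 \<union> S))"
    by (rule connected_Un) (use S in auto)
  moreover have "(ball 0 1 \<union> S) \<union> (- cball 0 1 \<union> S) = - E"
    using assms(1) by (fastforce simp: S_def)
  ultimately show ?thesis by simp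
qed

section \<open>Simultaneous approximation\<close>

lemma continuous_logarithm_on_log_capacity_0:
  assumes E: "compact E" "E \<subseteq> sphere 0 1" and cap: "log_capacity E = 0"
    and f: "continuous_on E f" "\<And>z. z \<in> E \<Longrightarrow> f z \<noteq> (0::complex)"
  obtains F where "continuous_on E F" "\<And>z. z \<in> E \<Longrightarrow> f z = exp (F z)"
proof -
  have "connected (- E)"
    using connected_complement_proper_subset_circle[OF E(2) log_capacity_0_neq_circle[OF E cap]] .
  then have "Borsukian E" using Borsukian_separation_compact[OF E(1)] by simp
  then show thesis
    using that f unfolding Borsukian_continuous_logarithm by (metis ComplI Pi_I singletonD)
qed

lemma poly_in_dirichlet_space: "poly P \<in> dirichlet_space"
  by (rule holomorphic_imp_dirichlet_space[of _ 2]) (auto intro!: holomorphic_intros)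

text \<open>The Dirichlet error is split into thirds, for the dilation, the cutoff perturbation and
  the Taylor polynomial; the error on \<open>E\<close> into halves, for \<open>h\<close> against
  \<open>f\<close> and for the Taylor polynomial.\<close>

lemma nonvanishing_polynomial_approximation:
  assumes E: "compact E" "E \<subseteq> sphere 0 1" and cap: "log_capacity E = 0"
    and g: "g \<in> dirichlet_space" "\<And>z. z \<in> ball 0 1 \<Longrightarrow> g z \<noteq> 0"
    and f: "continuous_on E f" "\<And>z. z \<in> E \<Longrightarrow> f z \<noteq> 0" and \<delta>: "0 < \<delta>"
  obtains P :: "complex poly" where "\<And>z. z \<in> cball 0 1 \<Longrightarrow> poly P z \<noteq> 0"
    and "dirichlet_norm (\<lambda>z. poly P z - g z) < \<delta>"
    and "\<And>z. z \<in> E \<Longrightarrow> cmod (poly P z - f z) < \<delta>"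
proof -
  have "eventually (\<lambda>r. dirichlet_norm (\<lambda>z. g (of_real r * z) - g z) < \<delta> / 3) (at_left (1::real))"
    using \<delta> by (intro order_tendstoD(2)[OF dirichlet_norm_dilation_tendsto_0[OF g(1)]]) simp
  moreover have "eventually (\<lambda>r::real. 0 < r \<and> r < 1) (at_left 1)"
    using eventually_at_left_real[of 0 "1::real"] by simp
  ultimately have "eventually (\<lambda>r. dirichlet_norm (\<lambda>z. g (of_real r * z) - g z) < \<delta> / 3 \<and> 0 < r \<and> r < 1) (at_left (1::real))"
    by eventually_elim simp
  then obtain r where r: "0 < r" "r < 1" and dil: "dirichlet_norm (\<lambda>z. g (of_real r * z) - g z) < \<delta> / 3"
    using eventually_happens'[OF trivial_limit_at_left_real] by blast
  define R1 where "R1 = 1 / r"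
  have R1: "1 < R1" using r by (simp add: R1_def)
  \<comment> \<open>The dilation is zero-free on a disc containing \<open>E\<close>, so it has a
    holomorphic logarithm there that can be subtracted from \<open>F\<close> on
    \<open>E\<close>.\<close>
  define gr where "gr z = g (of_real r * z)" for z
  have in_ball: "of_real r * z \<in> ball 0 1" if "z \<in> ball 0 R1" for z :: complex
    using that r by (simp add: R1_def norm_mult field_simps)
  have hol_gr: "gr holomorphic_on ball 0 R1"
    unfolding gr_def
    by (rule holomorphic_on_compose_gen[of "\<lambda>z. of_real r * z" _ g "ball 0 1", unfolded o_def])
      (use g(1) in_ball in \<open>auto simp: dirichlet_space_def intro!: holomorphic_intros\<close>)
  obtain G where G: "G holomorphic_on ball 0 R1" and exp_G: "\<And>z. z \<in> ball 0 R1 \<Longrightarrow> exp (G z) = gr z"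
  proof (rule holomorphic_logarithm_exists[of "ball 0 R1" gr 0])
    show "gr z \<noteq> 0" if "z \<in> ball 0 R1" for z
      using g(2)[OF in_ball[OF that]] by (simp add: gr_def)
  qed (use hol_gr R1 in auto)
  obtain F where F: "continuous_on E F" and exp_F: "\<And>z. z \<in> E \<Longrightarrow> f z = exp (F z)"
    using continuous_logarithm_on_log_capacity_0[OF E cap f] by blast
  have "bounded (F ` E)"
    using F E(1) by (intro compact_imp_bounded compact_continuous_image)
  then obtain b where b: "\<And>z. z \<in> E \<Longrightarrow> cmod (F z) \<le> b"
    by (auto simp: bounded_iff)
  \<comment> \<open>On \<open>E\<close> the exponent \<open>Q\<close> will differ from
    \<open>F\<close> by at most \<open>2 * \<eta> \<le> 1\<close>, so both have real part at most
    \<open>b + 1\<close>, where \<open>exp\<close> has Lipschitz constant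
    \<open>exp (b + 1)\<close>.\<close>
  define \<eta> where "\<eta> = min (1 / 2) (\<delta> / (4 * exp (b + 1)))"
  have \<eta>: "0 < \<eta>" "\<eta> \<le> 1 / 2" "exp (b + 1) * (2 * \<eta>) \<le> \<delta> / 2"
  proof -
    show "0 < \<eta>" "\<eta> \<le> 1 / 2" using \<delta> by (auto simp: \<eta>_def)
    have "\<eta> \<le> \<delta> / (4 * exp (b + 1))" by (simp add: \<eta>_def)
    then show "exp (b + 1) * (2 * \<eta>) \<le> \<delta> / 2" by (simp add: le_divide_eq mult_ac)
  qed
  have E_R1: "E \<subseteq> ball 0 R1" using E(2) R1 by auto
  have "continuous_on E (\<lambda>z. F z - G z)"
    using F continuous_on_subset[OF holomorphic_on_imp_continuous_on[OF G] E_R1] by (intro continuous_intros)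
  from disc_approximable_continuous[OF E cap this]
  obtain R2 p where R2: "1 < R2" and p: "p holomorphic_on ball 0 R2"
    and p_near: "\<And>z. z \<in> E \<Longrightarrow> cmod (p z - (F z - G z)) \<le> \<eta>"
    unfolding disc_approximable_def using \<eta>(1) by meson
  have "disc_approximable E p" using p R2 by (rule disc_approximable_holomorphic)
  then obtain a where a: "0 \<le> a" "\<And>z. z \<in> E \<Longrightarrow> cmod (p z) \<le> a"
    by (rule disc_approximable_bounded[OF _ E(1)]) (use E(2) in auto)
  \<comment> \<open>Chosen so that the defect \<open>exp (- M) * |p|\<close> of the cutoff on
    \<open>E\<close> is at most \<open>\<eta>\<close>; \<open>a + 1\<close> keeps the argument of
    \<open>ln\<close> positive when \<open>a = 0\<close>.\<close>
  define M where "M = max 0 (ln ((a + 1) / \<eta>))"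
  have M: "0 \<le> M" "exp (- M) * a \<le> \<eta>"
  proof -
    have "(a + 1) / \<eta> = exp (ln ((a + 1) / \<eta>))"
      using a(1) \<eta>(1) by simp
    also have "\<dots> \<le> exp M" by (simp only: exp_le_cancel_iff M_def max.cobounded2)
    finally have "exp (- M) * (a + 1) \<le> \<eta>"
      using \<eta>(1) by (simp add: exp_minus field_simps)
    moreover have "exp (- M) * a \<le> exp (- M) * (a + 1)" by (rule mult_left_mono) auto
    ultimately show "exp (- M) * a \<le> \<eta>" by linarith
  qed (simp add: M_def)
  define R where "R = min R1 R2"
  have R: "1 < R" "R \<le> R1" "R \<le> R2" using R1 R2 by (auto simp: R_def)
  have G_R: "G holomorphic_on ball 0 R" and p_R: "p holomorphic_on ball 0 R"
    using G p R by (auto intro: holomorphic_on_subset)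
  obtain C where C: "0 \<le> C" and perturb: "\<And>R' u. \<lbrakk>1 < R'; R' \<le> R; u holomorphic_on ball 0 R';
      \<And>z. z \<in> cball 0 1 \<Longrightarrow> - 1 \<le> Re (u z)\<rbrakk> \<Longrightarrow>
      dirichlet_norm (\<lambda>z. exp (G z + (1 - exp (- of_real M * u z)) * p z) - exp (G z)) \<le> C * dirichlet_norm u"
    using exp_of_cutoff_perturbation[OF G_R p_R R(1) M(1)] by blast
  have "0 < \<delta> / (3 * (C + 1))" using \<delta> C by simp
  from small_potential[OF E cap this] obtain R3 u where R3: "1 < R3" and u3: "u holomorphic_on ball 0 R3"
    and Re_u: "\<And>z. z \<in> cball 0 1 \<Longrightarrow> - 1 \<le> Re (u z)" and Re_u_E: "\<And>z. z \<in> E \<Longrightarrow> 1 \<le> Re (u z)"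
    and nu: "dirichlet_norm u \<le> \<delta> / (3 * (C + 1))"
    by metis
  define R' where "R' = min R R3"
  have R': "1 < R'" "R' \<le> R" "R' \<le> R3" using R R3 by (auto simp: R'_def)
  have sub: "ball 0 R' \<subseteq> ball (0::complex) R" "ball 0 R' \<subseteq> ball (0::complex) R3" "cball 0 1 \<subseteq> ball (0::complex) R'"
    using R' by auto
  have u: "u holomorphic_on ball 0 R'" using u3 sub(2) by (rule holomorphic_on_subset)
  define Q where "Q z = G z + (1 - exp (- of_real M * u z)) * p z" for z
  define h where "h z = exp (Q z)" for z
  have hol_h: "h holomorphic_on ball 0 R'"
    unfolding h_def Q_def
    by (intro holomorphic_intros u holomorphic_on_subset[OF G_R sub(1)] holomorphic_on_subset[OF p_R sub(1)])
  have h_gr: "dirichlet_norm (\<lambda>z. h z - gr z) \<le> \<delta> / 3"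
  proof -
    \<comment> \<open>\<open>gr\<close> and \<open>exp G\<close> are known to agree only near the
      closed disc, not as functions on the plane, so the norms are equated through derivatives at
      0.\<close>
    have "taylor_coeff (\<lambda>z. h z - gr z) k = taylor_coeff (\<lambda>z. h z - exp (G z)) k" for k
      unfolding taylor_coeff_def
    proof (rule arg_cong[of _ _ "\<lambda>x. x / _"], rule higher_deriv_transform_within_open[of _ "ball 0 R'"])
      show "(\<lambda>z. h z - gr z) holomorphic_on ball 0 R'"
        by (intro holomorphic_intros hol_h holomorphic_on_subset[OF hol_gr]) (use R R' in auto)
      show "(\<lambda>z. h z - exp (G z)) holomorphic_on ball 0 R'"
        by (intro holomorphic_intros hol_h holomorphic_on_subset[OF G_R sub(1)])
      show "h z - gr z = h z - exp (G z)" if "z \<in> ball 0 R'" for z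
        using exp_G[of z] that R R' by auto
    qed (use R' in auto)
    then have "dirichlet_norm (\<lambda>z. h z - gr z) = dirichlet_norm (\<lambda>z. h z - exp (G z))"
      by (simp add: dirichlet_norm_def)
    also have "\<dots> \<le> C * dirichlet_norm u"
      unfolding h_def Q_def by (rule perturb[OF R'(1,2) u Re_u])
    also have "\<dots> \<le> C * (\<delta> / (3 * (C + 1)))"
      using nu C by (rule mult_left_mono)
    also have "\<dots> \<le> (C + 1) * (\<delta> / (3 * (C + 1)))"
      using C \<delta> by (intro mult_right_mono) auto
    also have "\<dots> = \<delta> / 3" using C by (simp add: field_simps)
    finally show ?thesis .
  qed
  have h_f: "cmod (h z - f z) \<le> \<delta> / 2" if z: "z \<in> E" for z
  proof -
    have "M \<le> M * Re (u z)" using mult_left_mono[OF Re_u_E[OF z] M(1)] by simp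
    then have "cmod (exp (- of_real M * u z)) \<le> exp (- M)" by simp
    then have "cmod (exp (- of_real M * u z) * p z) \<le> exp (- M) * a"
      unfolding norm_mult using a(2)[OF z] by (intro mult_mono) auto
    then have "cmod (exp (- of_real M * u z) * p z) \<le> \<eta>" using M(2) by linarith
    moreover have QF_eq: "Q z - F z = (p z - (F z - G z)) - exp (- of_real M * u z) * p z"
      by (simp add: Q_def algebra_simps)
    ultimately have QF: "cmod (Q z - F z) \<le> 2 * \<eta>"
      using norm_triangle_ineq4[of "p z - (F z - G z)" "exp (- of_real M * u z) * p z"] p_near[OF z]
      unfolding QF_eq by linarith
    have ReF: "Re (F z) \<le> b"
      using complex_Re_le_cmod[of "F z"] b[OF z] by linarith
    have "Re (Q z) = Re (F z) + Re (Q z - F z)" by simp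
    also have "\<dots> \<le> b + 1"
      using ReF complex_Re_le_cmod[of "Q z - F z"] QF \<eta>(2) by linarith
    finally have "cmod (exp (Q z) - exp (F z)) \<le> exp (b + 1) * cmod (Q z - F z)"
      using ReF by (intro norm_exp_diff_le) auto
    also have "\<dots> \<le> exp (b + 1) * (2 * \<eta>)"
      using QF by (intro mult_left_mono) auto
    finally show ?thesis using \<eta>(3) exp_F[OF z] by (simp add: h_def)
  qed
  define T where "T n = (\<Sum>k<n. monom (taylor_coeff h k) k)" for n
  note T = taylor_polynomials_converge[OF hol_h R'(1), folded T_def]
  have "continuous_on (cball 0 1) h"
    using holomorphic_on_imp_continuous_on[OF hol_h] sub(3) by (rule continuous_on_subset)
  then have "continuous_on (cball 0 1) (\<lambda>z. cmod (h z))"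
    by (intro continuous_intros)
  \<comment> \<open>As an exponential, \<open>h\<close> has positive minimum modulus on the closed
    disc; a polynomial uniformly closer to \<open>h\<close> than this minimum has no zero
    there.\<close>
  then obtain z0 where z0: "z0 \<in> cball 0 1" "\<And>z. z \<in> cball 0 1 \<Longrightarrow> cmod (h z0) \<le> cmod (h z)"
    using continuous_attains_inf[of "cball 0 (1::real)" "\<lambda>z. cmod (h z)"] by auto
  have "cmod (h z0) > 0" by (simp add: h_def)
  then have "0 < min (cmod (h z0)) (\<delta> / 2)" using \<delta> by simp
  from uniform_limitD[OF T(1) this] order_tendstoD(2)[OF T(2), of "\<delta> / 3"] \<delta>
  have "eventually (\<lambda>n. (\<forall>z\<in>cball 0 1. dist (poly (T n) z) (h z) < min (cmod (h z0)) (\<delta> / 2)) \<and>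
      dirichlet_norm (\<lambda>z. poly (T n) z - h z) < \<delta> / 3) sequentially"
    by (auto intro: eventually_conj)
  then obtain n where n: "\<And>z. z \<in> cball 0 1 \<Longrightarrow> dist (poly (T n) z) (h z) < min (cmod (h z0)) (\<delta> / 2)"
    "dirichlet_norm (\<lambda>z. poly (T n) z - h z) < \<delta> / 3"
    using eventually_happens by fastforce
  show thesis
  proof (rule that[of "T n"])
    show "poly (T n) z \<noteq> 0" if "z \<in> cball 0 1" for z
      using n(1)[OF that] z0(2)[OF that] by (auto simp: dist_norm)
    note D = poly_in_dirichlet_space[of "T n"] holomorphic_imp_dirichlet_space[OF hol_h R'(1)]
      holomorphic_imp_dirichlet_space[OF hol_gr R1]
    have "dirichlet_norm (\<lambda>z. poly (T n) z - g z) \<le>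
        dirichlet_norm (\<lambda>z. poly (T n) z - h z) + dirichlet_norm (\<lambda>z. h z - g z)"
      by (intro dirichlet_norm_triangle D g)
    also have "dirichlet_norm (\<lambda>z. h z - g z) \<le>
        dirichlet_norm (\<lambda>z. h z - gr z) + dirichlet_norm (\<lambda>z. gr z - g z)"
      by (intro dirichlet_norm_triangle D g)
    finally show "dirichlet_norm (\<lambda>z. poly (T n) z - g z) < \<delta>"
      using n(2) h_gr dil unfolding gr_def by linarith
    show "cmod (poly (T n) z - f z) < \<delta>" if z: "z \<in> E" for z
    proof -
      have "z \<in> cball 0 1" using z E(2) by auto
      from n(1)[OF this] h_f[OF z] norm_triangle_ineq[of "poly (T n) z - h z" "h z - f z"]
      show ?thesis by (simp add: dist_norm)
    qed
  qed
qed

theorem theorem4p2: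
  fixes E :: "complex set" and g f :: "complex \<Rightarrow> complex"
  assumes "closed E" and "E \<subseteq> sphere 0 1" and "log_capacity E = 0"
    and "g \<in> dirichlet_space" and "\<forall>z\<in>ball 0 1. g z \<noteq> 0"
    and "continuous_on E f" and "\<forall>z\<in>E. f z \<noteq> 0"
  shows "\<exists>P :: nat \<Rightarrow> complex poly.
           (\<forall>n. \<forall>z\<in>cball 0 1. poly (P n) z \<noteq> 0) \<and>
           (\<lambda>n. dirichlet_norm (\<lambda>z. poly (P n) z - g z)) \<longlonglongrightarrow> 0 \<and>
           uniform_limit E (\<lambda>n. poly (P n)) f sequentially"
proof -
  have E: "compact E"
    using assms(1,2) bounded_subset[OF bounded_sphere] by (auto simp: compact_eq_bounded_closed)
  have "\<exists>P :: complex poly. (\<forall>z\<in>cball 0 1. poly P z \<noteq> 0) \<and>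
      dirichlet_norm (\<lambda>z. poly P z - g z) < inverse (real (Suc n)) \<and>
      (\<forall>z\<in>E. cmod (poly P z - f z) < inverse (real (Suc n)))" for n
  proof -
    have pos: "0 < inverse (real (Suc n))" by simp
    show ?thesis
    proof (rule nonvanishing_polynomial_approximation[OF E assms(2-4) _ assms(6) _ pos])
      fix P :: "complex poly"
      assume "\<And>z. z \<in> cball 0 1 \<Longrightarrow> poly P z \<noteq> 0"
        "dirichlet_norm (\<lambda>z. poly P z - g z) < inverse (real (Suc n))"
        "\<And>z. z \<in> E \<Longrightarrow> cmod (poly P z - f z) < inverse (real (Suc n))"
      then show ?thesis by (intro exI[of _ P]) simp
    qed (use assms(5,7) in auto)
  qed
  then obtain P :: "nat \<Rightarrow> complex poly" where nz: "\<And>n. \<forall>z\<in>cball 0 1. poly (P n) z \<noteq> 0"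
    and dir: "\<And>n. dirichlet_norm (\<lambda>z. poly (P n) z - g z) < inverse (real (Suc n))"
    and uni: "\<And>n. \<forall>z\<in>E. cmod (poly (P n) z - f z) < inverse (real (Suc n))"
    by metis
  have "(\<lambda>n. dirichlet_norm (\<lambda>z. poly (P n) z - g z)) \<longlonglongrightarrow> 0"
  proof (rule tendsto_sandwich[OF _ _ tendsto_const LIMSEQ_inverse_real_of_nat])
    \<comment> \<open>Nonnegativity rests on membership of the difference in the Dirichlet space,
      since \<open>suminf\<close> is meaningful only for a summable series.\<close>
    show "eventually (\<lambda>n. 0 \<le> dirichlet_norm (\<lambda>z. poly (P n) z - g z)) sequentially"
      by (intro always_eventually allI dirichlet_norm_nonneg dirichlet_space_diff
          poly_in_dirichlet_space assms(4))
    show "eventually (\<lambda>n. dirichlet_norm (\<lambda>z. poly (P n) z - g z) \<le> inverse (real (Suc n))) sequentially"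
      by (intro always_eventually allI less_imp_le dir)
  qed
  moreover have "uniform_limit E (\<lambda>n. poly (P n)) f sequentially"
  proof (rule uniform_limitI)
    fix e :: real assume "0 < e"
    then have "eventually (\<lambda>n. inverse (real (Suc n)) < e) sequentially"
      by (rule order_tendstoD(2)[OF LIMSEQ_inverse_real_of_nat])
    then show "eventually (\<lambda>n. \<forall>z\<in>E. dist (poly (P n) z) (f z) < e) sequentially"
    proof eventually_elim
      case (elim n)
      then show ?case using uni[of n] by (force simp: dist_norm)
    qed
  qed
  ultimately show ?thesis using nz by blast
qed

end
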